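(* Let $p$ be a prime, $n\ge2$, $q=p^n$. For every $\vec b\in(\mathbb{Z}/2)^n$, the image under $V$ of $H^1_{\rm dR}(X_q)_{\vec b}$ equals $H^1_{\rm dR}(X_q)_{\vec{Vb}}$ and the image under $F$ of $H^1_{\rm dR}(X_q)_{\vec b}$ equals $H^1_{\rm dR}(X_q)_{\vec{Fb}}$ (the paper writes $VH^1_{\rm dR}(X_q)_{\vec b}\cong H^1_{\rm dR}(X_q)_{\vec{Vb}}$ and $FH^1_{\rm dR}(X_q)_{\vec b}\cong H^1_{\rm dR}(X_q)_{\vec{Fb}}$).
   Context: $k$ is an algebraically closed field of characteristic $p$ and $X_q$ is the Hermitian curve $y^q+y=x^{q+1}$ over $k$ (smooth projective, unique point $P_\infty$ at infinity). Let $U_1=X_q\setminus\{P_\infty\}$, $U_2=X_q\setminus\{(0,y):y^q+y=0\}$; $H^1_{\rm dR}(X_q)$ is the space of triples $(\phi,\eta_1,\eta_2)$ with $\phi\in\mathcal{O}(U_1\cap U_2)$, $\eta_i\in\Omega^1(U_i)$, $d\phi=\eta_1-\eta_2$, modulo triples $(\kappa_1-\kappa_2,d\kappa_1,d\kappa_2)$, $\kappa_i\in\mathcal{O}(U_i)$. $F(\phi,\eta)=(\phi^p,0)$ and $V(\phi,\eta)=(0,\mathcal{C}(\eta))$, $\mathcal{C}$ the Cartier operator. Let $\Delta=\{(i,j)\in\mathbb{Z}^2:i,j\ge0,i+j\le q-2\}$; for $(i,j)\in\Delta$, $\omega_{i,j}=x^iy^jdx\in H^0(X_q,\Omega^1)\subset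 H^1_{\rm dR}(X_q)$, $f_{i,j}=\frac{y^{q-1}}{x^{i+1}y^j}$, and $\tilde f_{i,j}$ is the class of $(f_{i,j},\,-(j+1)y^{q-j-2}x^{q-i-1}dx,\,(i+1)y^{q-j-1}x^{-i-2}dx)$. These $\omega_{i,j},\tilde f_{i,j}$ form a basis $\mathbb{B}$. For $0\le m<p^n$ write $m=\sum m_lp^l$ ($0\le m_l\le p-1$), $m^+_h=\sum_{l=0}^{h-1}m_lp^l$. For $(i,j)\in\Delta$, $0\le h\le n-2$: $b_h(i,j)=0$ if $i^+_{h+1}+j^+_{h+1}<p^{h+1}-1$, else $1$. The vector of $\omega_{i,j}$ is $(b_0(i,j),\dots,b_{n-2}(i,j),1)$ and of $\tilde f_{i,j}$ is $(b_0(i,j),\dots,b_{n-2}(i,j),0)$. For $\vec b\in(\mathbb{Z}/2)^n$, $H^1_{\rm dR}(X_q)_{\vec b}$ is the span of the elements of $\mathbb{B}$ with vector $\vec b$, and $H^1_{\rm dR}(X_q)_0:=0$ (here $0$ is a formal symbol, not the zero vector). Let $\iota$ swap $0$ and $1$. For $\vec b=(b_0,\dots,b_{n-1})$ define: (1) if $b_{n-1}=1,b_0=0$: $\vec{Vb}=0$; if $b_{n-1}=1,b_0=1$: $\vec{Vb}=(b_1,\dots,b_{n-2},0,1)$. (2) If $b_{n-1}=0,b_0=1$: $\vec{Vb}=0$; if $b_{n-1}=0,b_0=0$: $\vec{Vb}=(\iota(b_1),\dots,\iota(b_{n-2}),1,1)$. (3) If $b_{n-1}=1$: $\vec{Fb}=0$.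 (4) If $b_{n-1}=0,b_{n-2}=0$: $\vec{Fb}=(1,b_0,\dots,b_{n-3},0)$; if $b_{n-1}=0,b_{n-2}=1$: $\vec{Fb}=(0,\iota(b_0),\dots,\iota(b_{n-3}),1)$. *)

theory Defs
  imports
    "HOL-Computational_Algebra.Computational_Algebra"
    "HOL-Library.Function_Algebras"
    "HOL-Library.Product_Plus"
    "HOL-Library.Z2"
begin

text \<open>
  The Hermitian curve is handled through its function field: \<^typ>\<open>'F\<close> is the function field,
  \<open>emb\<close> the embedding of the constant field \<^typ>\<open>'k\<close>, and \<open>x\<close>, \<open>y\<close> are the coordinate functions.
  The polynomial \<open>Y^q + Y - x^(q+1)\<close> is irreducible over \<open>k(x)\<close>, so the assumptions of
  the locale below determine \<open>('F, emb, x, y)\<close> up to isomorphism.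
\<close>

text \<open>In a bivariate polynomial of type \<^typ>\<open>'a poly poly\<close>, the first argument \<open>a\<close> is
  substituted for the inner variable and the second argument \<open>b\<close> for the outer one.\<close>

definition eval2 :: "('a::comm_semiring_0 \<Rightarrow> 'b::comm_semiring_0) \<Rightarrow> 'a poly poly \<Rightarrow> 'b \<Rightarrow> 'b \<Rightarrow> 'b"
  where "eval2 h G a b = poly (map_poly (\<lambda>c. poly (map_poly h c) a) G) b"

datatype 'k point = Affine 'k 'k | Infty

text \<open>
  A differential of the function field is represented as a functional on the
  \<open>k\<close>-derivations \<open>D\<close> of \<^typ>\<open>'F\<close>, with \<open>d f = (D \<mapsto> D f)\<close>. As \<^typ>\<open>'F\<close> is finitely generated over
  the perfect field \<^typ>\<open>'k\<close>, this identifies the Kaehler differentials with the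
  \<^typ>\<open>'F\<close>-span of the functionals \<open>d f\<close> (the dual of the space of derivations). Outside the set of
  derivations the functionals are \<open>0\<close>, so that equality of differentials is equality of functions.
\<close>

type_synonym 'F differential = "('F \<Rightarrow> 'F) \<Rightarrow> 'F"

type_synonym 'F triple = "'F \<times> 'F differential \<times> 'F differential"

definition scaleD :: "'F::times \<Rightarrow> 'F differential \<Rightarrow> 'F differential"
  where "scaleD f \<omega> = (\<lambda>D. f * \<omega> D)"

datatype basis_symbol = Om nat nat | Ft nat nat

text \<open>\<open>trunc p h m\<close> is \<open>m^+_h\<close>.\<close>

definition digit :: "nat \<Rightarrow> nat \<Rightarrow> nat \<Rightarrow> nat"
  where "digit p m l = (m div p ^ l) mod p"

definition trunc :: "nat \<Rightarrow> nat \<Rightarrow> nat \<Rightarrow> nat"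
  where "trunc p h m = (\<Sum>l<h. digit p m l * p ^ l)"

definition bvec_entry :: "nat \<Rightarrow> nat \<Rightarrow> nat \<Rightarrow> nat \<Rightarrow> bit"
  where "bvec_entry p h i j =
    (if trunc p (h + 1) i + trunc p (h + 1) j < p ^ (h + 1) - 1 then 0 else 1)"

fun bvec :: "nat \<Rightarrow> nat \<Rightarrow> basis_symbol \<Rightarrow> bit list"
  where
    "bvec p n (Om i j) = map (\<lambda>h. bvec_entry p h i j) [0..<n - 1] @ [1]"
  | "bvec p n (Ft i j) = map (\<lambda>h. bvec_entry p h i j) [0..<n - 1] @ [0]"

text \<open>A vector in \<open>(Z/2)^n\<close> is a list of length \<open>n\<close>; \<^const>\<open>None\<close> is the formal symbol \<open>0\<close>,
  which is not the zero vector.\<close>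

definition swap01 :: "bit \<Rightarrow> bit"
  where "swap01 a = (if a = 0 then 1 else 0)"

definition Vvec :: "bit list \<Rightarrow> bit list option"
  where "Vvec b = (let n = length b in
    if b ! (n - 1) = 1 then
      (if b ! 0 = 0 then None
       else Some (map (\<lambda>h. b ! h) [1..<n - 1] @ [0, 1]))
    else
      (if b ! 0 = 1 then None
       else Some (map (\<lambda>h. swap01 (b ! h)) [1..<n - 1] @ [1, 1])))"

definition Fvec :: "bit list \<Rightarrow> bit list option"
  where "Fvec b = (let n = length b in
    if b ! (n - 1) = 1 then None
    else if b ! (n - 2) = 0 then Some ([1] @ map (\<lambda>h. b ! h) [0..<n - 2] @ [0])
    else Some ([0] @ map (\<lambda>h. swap01 (b ! h)) [0..<n - 2] @ [1]))"

locale hermitian_curve =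
  fixes p n :: nat
    and emb :: "'k::alg_closed_field \<Rightarrow> 'F::field"
    and x y :: 'F
  assumes prime_p: "prime p"
    and char_k: "CHAR('k) = p"
    and n_ge_2: "2 \<le> n"
    and emb_add: "\<And>a b. emb (a + b) = emb a + emb b"
    and emb_mult: "\<And>a b. emb (a * b) = emb a * emb b"
    and emb_one: "emb 1 = 1"
    and x_transcendental: "\<And>g. poly (map_poly emb g) x = 0 \<Longrightarrow> g = 0"
    and curve_eq: "y ^ (p ^ n) + y = x ^ (p ^ n + 1)"
    and generated: "\<And>f. \<exists>G H. eval2 emb H x y \<noteq> 0 \<and> f = eval2 emb G x y / eval2 emb H x y"
begin

abbreviation q :: nat
  where "q \<equiv> p ^ n"

text \<open>
  The points are those of the plane projective model \<open>Y^q Z + Y Z^q = X^(q+1)\<close>. Its only point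
  with \<open>Z = 0\<close> is \<open>[0:1:0]\<close>, which is the origin of the chart with coordinates \<open>X/Y = x/y\<close> and
  \<open>Z/Y = 1/y\<close>. The model is smooth, hence so is the curve at each of these points.
\<close>

definition curve :: "'k point set"
  where "curve = {Affine a b |a b. b ^ q + b = a ^ (q + 1)} \<union> {Infty}"

definition U1 :: "'k point set"
  where "U1 = curve - {Infty}"

definition U2 :: "'k point set"
  where "U2 = curve - {Affine 0 b |b. b ^ q + b = 0}"

definition chart_local_ring :: "'F \<Rightarrow> 'F \<Rightarrow> 'k \<Rightarrow> 'k \<Rightarrow> 'F set"
  where "chart_local_ring u v a b =
    {eval2 emb G u v / eval2 emb H u v |G H. eval2 (\<lambda>c. c) H a b \<noteq> 0}"

primrec local_ring :: "'k point \<Rightarrow> 'F set"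
  where
    "local_ring (Affine a b) = chart_local_ring x y a b"
  | "local_ring Infty = chart_local_ring (x / y) (1 / y) 0 0"

definition regular :: "'k point set \<Rightarrow> 'F set"
  where "regular U = {f. \<forall>P\<in>U. f \<in> local_ring P}"

definition derivations :: "('F \<Rightarrow> 'F) set"
  where "derivations = {D. (\<forall>f g. D (f + g) = D f + D g) \<and>
    (\<forall>f g. D (f * g) = f * D g + g * D f) \<and> (\<forall>c. D (emb c) = 0)}"

definition d :: "'F \<Rightarrow> 'F differential"
  where "d f = (\<lambda>D. if D \<in> derivations then D f else 0)"

text \<open>The stalk of the sheaf of differentials at \<open>P\<close> is the submodule over the local ring that
  is generated by the differentials of its elements; it embeds in the differentials of the function
  field because the curve is smooth.\<close>

definition regular_forms :: "'k point set \<Rightarrow> 'F differential set"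
  where "regular_forms U = {\<omega>. \<forall>P\<in>U. \<exists>(m::nat) f g.
    (\<forall>i<m. f i \<in> local_ring P \<and> g i \<in> local_ring P) \<and>
    \<omega> = (\<Sum>i<m. scaleD (f i) (d (g i)))}"

definition cocycles :: "'F triple set"
  where "cocycles = {(\<phi>, \<eta>1, \<eta>2). \<phi> \<in> regular (U1 \<inter> U2) \<and>
    \<eta>1 \<in> regular_forms U1 \<and> \<eta>2 \<in> regular_forms U2 \<and> d \<phi> = \<eta>1 - \<eta>2}"

definition coboundaries :: "'F triple set"
  where "coboundaries = {(\<kappa>1 - \<kappa>2, d \<kappa>1, d \<kappa>2) |\<kappa>1 \<kappa>2. \<kappa>1 \<in> regular U1 \<and> \<kappa>2 \<in> regular U2}"

definition cohomologous :: "('F triple \<times> 'F triple) set"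
  where "cohomologous = {(s, t). s \<in> cocycles \<and> t \<in> cocycles \<and> s - t \<in> coboundaries}"

definition H1dR :: "'F triple set set"
  where "H1dR = cocycles // cohomologous"

definition dR_class :: "'F triple \<Rightarrow> 'F triple set"
  where "dR_class t = cohomologous `` {t}"

primrec scale_triple :: "'k \<Rightarrow> 'F triple \<Rightarrow> 'F triple"
  where "scale_triple c (\<phi>, \<eta>) =
    (emb c * \<phi>, scaleD (emb c) (fst \<eta>), scaleD (emb c) (snd \<eta>))"

text \<open>The operations on classes are induced from representatives; each union below is a union of
  equal classes.\<close>

definition dR_add :: "'F triple set \<Rightarrow> 'F triple set \<Rightarrow> 'F triple set"
  where "dR_add A B = (\<Union>s\<in>A. \<Union>t\<in>B. dR_class (s + t))"

definition dR_scale :: "'k \<Rightarrow> 'F triple set \<Rightarrow> 'F triple set"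
  where "dR_scale c A = (\<Union>t\<in>A. dR_class (scale_triple c t))"

inductive_set dR_span :: "'F triple set set \<Rightarrow> 'F triple set set" for S
  where
    zero: "dR_class 0 \<in> dR_span S"
  | step: "\<lbrakk>A \<in> S; B \<in> dR_span S\<rbrakk> \<Longrightarrow> dR_add (dR_scale c A) B \<in> dR_span S"

text \<open>Cartier operator with respect to the separating variable \<open>x\<close>: every differential is
  \<open>(f_0^p + f_1^p x + ... + f_{p-1}^p x^(p-1)) dx\<close> for unique \<open>f_i\<close>, and is sent to \<open>f_{p-1} dx\<close>.\<close>

definition cartier :: "'F differential \<Rightarrow> 'F differential"
  where "cartier \<omega> = (THE \<omega>'. \<exists>f. \<omega> = scaleD (\<Sum>i<p. f i ^ p * x ^ i) (d x) \<and>
    \<omega>' = scaleD (f (p - 1)) (d x))"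

definition F :: "'F triple set \<Rightarrow> 'F triple set"
  where "F A = (\<Union>(\<phi>, \<eta>1, \<eta>2)\<in>A. dR_class (\<phi> ^ p, 0, 0))"

definition V :: "'F triple set \<Rightarrow> 'F triple set"
  where "V A = (\<Union>(\<phi>, \<eta>1, \<eta>2)\<in>A. dR_class (0, cartier \<eta>1, cartier \<eta>2))"

definition \<Delta> :: "(nat \<times> nat) set"
  where "\<Delta> = {(i, j). i + j \<le> q - 2}"

definition basis_symbols :: "basis_symbol set"
  where "basis_symbols = {Om i j |i j. (i, j) \<in> \<Delta>} \<union> {Ft i j |i j. (i, j) \<in> \<Delta>}"

text \<open>A global differential \<open>\<omega>\<close> is the class of \<open>(0, \<omega>, \<omega>)\<close>.\<close>

primrec basis_elem :: "basis_symbol \<Rightarrow> 'F triple set"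
  where
    "basis_elem (Om i j) =
      dR_class (0, scaleD (x ^ i * y ^ j) (d x), scaleD (x ^ i * y ^ j) (d x))"
  | "basis_elem (Ft i j) =
      dR_class (y ^ (q - 1) / (x ^ (i + 1) * y ^ j),
        scaleD (- of_nat (j + 1) * y ^ (q - j - 2) * x ^ (q - i - 1)) (d x),
        scaleD (of_nat (i + 1) * y ^ (q - j - 1) / x ^ (i + 2)) (d x))"

primrec H1dR_part :: "bit list option \<Rightarrow> 'F triple set set"
  where
    "H1dR_part None = {dR_class 0}"
  | "H1dR_part (Some b) = dR_span {basis_elem e |e. e \<in> basis_symbols \<and> bvec p n e = b}"

end

end

theory Submission
  imports Defs
begin

text \<open>
  Up to nonzero scalars and classes that vanish, \<open>F\<close> and \<open>V\<close> permute the basis elements, so the images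
  of the spans are read off from the base-\<open>p\<close> digits of the exponents; surjectivity holds because the
  constants are perfect. For \<open>V\<close>, write \<open>y^j = y^(p j') (x^(q+1) - y^q)^t\<close> with \<open>t\<close> the lowest digit of
  \<open>j\<close> and expand: the Cartier operator keeps at most one monomial. For \<open>F\<close>, expand
  the power \<open>(x^(q+1) - y)^N\<close> that occurs in \<open>f_{i,j}^p\<close>: all but one of the terms are regular on \<open>U1\<close> or
  on \<open>U2\<close>, and the derivatives of the terms telescope to a single monomial. The Cartier operator is
  well defined because the function field has a derivation with \<open>D x = 1\<close>.
\<close>

subsection \<open>Evaluation of bivariate polynomials\<close>

text \<open>The vectors record carries: b_h is the carry out of digit h when i + j + 1 is computed
  in base p. Moving the lowest digits to the top removes the lowest carry and keeps the others,
  which gives the plain shift. For f_{i,j} the remaining parts u, v are also replaced by r-1-u,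
  r-1-v with r = q/p, and complementing digits exchanges carry and no carry; this is the origin of
  the swap of 0 and 1. The lowest carry decides which elements \<open>V\<close> kills: the monomial
  x^(s+k) with k <= t reaches the exponent p-1 only if s + t + 1 >= p. The obstacle is that the
  function field is given by generators and one equation, without a normal form of its elements. The
  derivation is therefore built on polynomials, by X -> 1 and Y -> X^q, and descends to fractions;
  evaluating differentials at it then recovers their coefficients with respect to dx. Classes are
  handled through explicit triples, and images of spans are compared generator by generator modulo
  coboundaries.\<close>

context
  fixes h :: "'a::comm_ring_1 \<Rightarrow> 'b::comm_ring_1"
  assumes hom_add: "\<And>a b. h (a + b) = h a + h b"
    and hom_mult: "\<And>a b. h (a * b) = h a * h b"
    and hom_one: "h 1 = 1"
begin

lemma hom_zero: "h 0 = 0"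
  using hom_add[of 0 0] by simp

lemma hom_uminus: "h (- a) = - h a"
  using hom_add[of a "- a"] hom_zero by (simp add: eq_neg_iff_add_eq_0 add.commute)

lemma hom_sum: "h (sum f A) = (\<Sum>i\<in>A. h (f i))"
  by (induction A rule: infinite_finite_induct) (auto simp: hom_zero hom_add)

lemma hom_power: "h (a ^ m) = h a ^ m"
  by (induction m) (auto simp: hom_one hom_mult)

lemma hom_of_nat: "h (of_nat m) = of_nat m"
  by (induction m) (auto simp: hom_zero hom_one hom_add)

lemma poly_map_poly_hom_add:
  "poly (map_poly h (P + Q)) a = poly (map_poly h P) a + poly (map_poly h Q) a"
proof -
  have "map_poly h (P + Q) = map_poly h P + map_poly h Q"
    by (simp add: poly_eq_iff coeff_map_poly hom_zero hom_add)
  then show ?thesis by simp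
qed

lemma poly_map_poly_hom_mult:
  "poly (map_poly h (P * Q)) a = poly (map_poly h P) a * poly (map_poly h Q) a"
proof -
  have "map_poly h (P * Q) = map_poly h P * map_poly h Q"
    by (simp add: poly_eq_iff coeff_map_poly hom_zero coeff_mult hom_sum hom_mult)
  then show ?thesis by simp
qed

lemma poly_map_poly_hom_one: "poly (map_poly h 1) a = 1"
  by (simp add: map_poly_1 hom_one)

end

context
  fixes h :: "'a::comm_ring_1 \<Rightarrow> 'b::comm_ring_1"
  assumes hom: "\<And>a b. h (a + b) = h a + h b" "\<And>a b. h (a * b) = h a * h b" "h 1 = 1"
begin

lemmas inner_hom =
  poly_map_poly_hom_add[OF hom] poly_map_poly_hom_mult[OF hom] poly_map_poly_hom_one[OF hom]

text \<open>Evaluation is a univariate evaluation performed twice: by \<open>inner_hom\<close>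
  evaluating the coefficients at \<open>a\<close> is again a homomorphism, so the univariate facts
  apply to it in place of \<open>h\<close>.\<close>

lemma eval2_add: "eval2 h (G + H) a b = eval2 h G a b + eval2 h H a b"
  unfolding eval2_def by (rule poly_map_poly_hom_add) (simp_all add: inner_hom)

lemma eval2_mult: "eval2 h (G * H) a b = eval2 h G a b * eval2 h H a b"
  unfolding eval2_def by (rule poly_map_poly_hom_mult) (simp_all add: inner_hom)

lemma eval2_one: "eval2 h 1 a b = 1"
  unfolding eval2_def by (rule poly_map_poly_hom_one) (simp_all add: inner_hom)

lemma eval2_uminus: "eval2 h (- G) a b = - eval2 h G a b"
  by (rule hom_uminus[of "\<lambda>G. eval2 h G a b"]) (simp_all add: eval2_add eval2_mult eval2_one)

lemma eval2_diff: "eval2 h (G - H) a b = eval2 h G a b - eval2 h H a b"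
  using eval2_add[of G "- H"] eval2_uminus[of H] by simp

lemma eval2_power: "eval2 h (G ^ m) a b = eval2 h G a b ^ m"
  by (rule hom_power[of "\<lambda>G. eval2 h G a b"]) (simp_all add: eval2_add eval2_mult eval2_one)

lemma eval2_zero: "eval2 h 0 a b = 0"
  by (simp add: eval2_def)

lemma eval2_pCons: "eval2 h (pCons g G) a b = poly (map_poly h g) a + b * eval2 h G a b"
  by (simp add: eval2_def map_poly_pCons)

lemma eval2_inner: "eval2 h [:g:] a b = poly (map_poly h g) a"
  by (simp add: eval2_pCons eval2_zero)

lemma eval2_const: "eval2 h [:[:c:]:] a b = h c"
  by (simp add: eval2_inner map_poly_pCons hom_zero[OF hom])

lemma eval2_inner_var: "eval2 h [:[:0, 1:]:] a b = a"
  by (simp add: eval2_inner map_poly_pCons hom_zero[OF hom] hom(3))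

lemma eval2_outer_var: "eval2 h [:0, 1:] a b = b"
  by (simp add: eval2_pCons eval2_zero map_poly_pCons hom_zero[OF hom] hom(3))

text \<open>Both evaluations are Horner schemes, so closure under sums and products suffices. It
  serves to pass from constants, \<open>x\<close> and \<open>y\<close> to all polynomials in
  them.\<close>

lemma eval2_mem:
  assumes "\<And>c. h c \<in> M" "a \<in> M" "b \<in> M"
    and add: "\<And>f g. f \<in> M \<Longrightarrow> g \<in> M \<Longrightarrow> f + g \<in> M"
    and mult: "\<And>f g. f \<in> M \<Longrightarrow> g \<in> M \<Longrightarrow> f * g \<in> M"
  shows "eval2 h G a b \<in> M"
proof -
  have "0 \<in> M"
    using assms(1)[of 0] hom_zero[OF hom] by simp
  have inner: "poly (map_poly h g) a \<in> M" for g
    by (induction g) (use \<open>0 \<in> M\<close> assms hom_zero[OF hom] in \<open>auto simp: map_poly_pCons\<close>)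
  show ?thesis
    by (induction G) (use \<open>0 \<in> M\<close> assms inner in \<open>auto simp: eval2_zero eval2_pCons\<close>)
qed

end

subsection \<open>A derivation of the function field\<close>

text \<open>The derivation G_X + w G_Y, determined by X -> 1 for the inner variable, Y ->
  \<open>w\<close> for the outer one, and 0 on constants.\<close>

definition total_deriv :: "'a::idom poly \<Rightarrow> 'a poly poly \<Rightarrow> 'a poly poly"
  where "total_deriv w G = map_poly pderiv G + smult w (pderiv G)"

lemma total_deriv_add: "total_deriv w (G + H) = total_deriv w G + total_deriv w H"
proof -
  have "map_poly pderiv (G + H) = map_poly pderiv G + map_poly pderiv H"
    by (simp add: poly_eq_iff[of "map_poly pderiv (G + H)"] coeff_map_poly pderiv_add)
  then show ?thesis
    by (simp add: total_deriv_def pderiv_add smult_add_right)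
qed

lemma pderiv_sum: "pderiv (sum f A) = (\<Sum>i\<in>A. pderiv (f i))"
  by (induction A rule: infinite_finite_induct) (auto simp: pderiv_add)

lemma total_deriv_mult: "total_deriv w (G * H) = G * total_deriv w H + H * total_deriv w G"
proof -
  have "pderiv (f * g) = f * pderiv g + pderiv f * g" for f g :: "'a poly"
    by (simp add: pderiv_mult mult.commute)
  then have "map_poly pderiv (G * H) = G * map_poly pderiv H + map_poly pderiv G * H"
    by (intro poly_eqI) (simp add: coeff_map_poly coeff_mult pderiv_sum sum.distrib)
  then show ?thesis
    by (simp add: total_deriv_def pderiv_mult algebra_simps smult_add_right)
qed

lemma derivation_one:
  fixes D :: "'a::comm_ring_1 \<Rightarrow> 'a"
  assumes "\<And>f g. D (f * g) = f * D g + g * D f"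
  shows "D 1 = 0"
  using assms[of 1 1] by simp

lemma derivation_power:
  fixes D :: "'a::comm_ring_1 \<Rightarrow> 'a"
  assumes "\<And>f g. D (f * g) = f * D g + g * D f"
  shows "D (f ^ m) = of_nat m * f ^ (m - 1) * D f"
proof (induction m)
  case 0
  then show ?case using derivation_one[of D, OF assms] by simp
next
  case (Suc m)
  have "D (f ^ Suc m) = f * (of_nat m * f ^ (m - 1) * D f) + f ^ m * D f"
    using assms[of f "f ^ m"] Suc by simp
  also have "f * (of_nat m * f ^ (m - 1) * D f) = of_nat m * f ^ m * D f"
    by (cases m) (auto simp: algebra_simps)
  finally show ?case by (simp add: algebra_simps)
qed

lemma additive_diff:
  fixes D :: "'a::ab_group_add \<Rightarrow> 'b::ab_group_add"
  assumes "\<And>f g. D (f + g) = D f + D g"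
  shows "D (f - g) = D f - D g"
  using assms[of "f - g" g] by (simp add: algebra_simps)

lemma additive_zero:
  fixes D :: "'a::ab_group_add \<Rightarrow> 'b::ab_group_add"
  assumes "\<And>f g. D (f + g) = D f + D g"
  shows "D 0 = 0"
  using assms[of 0 0] by simp

lemma additive_uminus:
  fixes D :: "'a::ab_group_add \<Rightarrow> 'b::ab_group_add"
  assumes "\<And>f g. D (f + g) = D f + D g"
  shows "D (- f) = - D f"
  using additive_diff[of D 0 f, OF assms] additive_zero[of D, OF assms] by simp

lemma additive_sum:
  fixes D :: "'a::ab_group_add \<Rightarrow> 'b::ab_group_add"
  assumes "\<And>f g. D (f + g) = D f + D g"
  shows "D (sum f A) = (\<Sum>i\<in>A. D (f i))"
  by (induction A rule: infinite_finite_induct) (auto simp: assms additive_zero[of D, OF assms])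

context hermitian_curve
begin

lemmas emb_hom = emb_add emb_mult emb_one

lemma emb_zero: "emb 0 = 0" using hom_zero[of emb, OF emb_hom] .
lemma emb_uminus: "emb (- a) = - emb a" using hom_uminus[of emb, OF emb_hom] .
lemma emb_power: "emb (a ^ m) = emb a ^ m" using hom_power[of emb, OF emb_hom] .
lemma emb_of_nat: "emb (of_nat m) = of_nat m" using hom_of_nat[of emb, OF emb_hom] .

lemma emb_eq_zero_iff: "emb a = 0 \<longleftrightarrow> a = 0"
proof
  assume "emb a = 0"
  show "a = 0"
  proof (rule ccontr)
    assume "a \<noteq> 0"
    then have "emb a * emb (inverse a) = 1" by (simp flip: emb_mult add: emb_one)
    with \<open>emb a = 0\<close> show False by simp
  qed
qed (simp add: emb_zero)

lemma of_nat_F_eq_zero_iff: "of_nat m = (0 :: 'F) \<longleftrightarrow> p dvd m"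
  using emb_eq_zero_iff[of "of_nat m"] char_k by (simp add: emb_of_nat of_nat_eq_0_iff_char_dvd)

lemma char_F: "CHAR('F) = p"
  by (rule CHAR_eqI) (simp_all add: of_nat_F_eq_zero_iff)

lemma p_ge_2: "p \<ge> 2" using prime_p by (rule prime_ge_2_nat)

lemma q_pos: "q > 0" using p_ge_2 by simp

lemma of_nat_q: "of_nat q = (0 :: 'F)"
  using n_ge_2 by (simp add: of_nat_F_eq_zero_iff del: of_nat_power)

lemma x_nonzero: "x \<noteq> 0"
proof
  assume "x = 0"
  with x_transcendental[of "[:0, 1:]"] show False
    by (simp add: map_poly_pCons emb_zero emb_one)
qed

lemma y_nonzero: "y \<noteq> 0"
proof
  assume "y = 0"
  with curve_eq q_pos have "x ^ (q + 1) = 0" by (simp add: zero_power)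
  with x_nonzero show False by simp
qed

abbreviation ev :: "'k poly poly \<Rightarrow> 'F"
  where "ev G \<equiv> eval2 emb G x y"

lemmas ev_simps = eval2_add[OF emb_hom] eval2_mult[OF emb_hom] eval2_one[OF emb_hom]
  eval2_uminus[OF emb_hom] eval2_diff[OF emb_hom] eval2_power[OF emb_hom] eval2_zero[OF emb_hom]
  eval2_const[OF emb_hom] eval2_inner_var[OF emb_hom] eval2_outer_var[OF emb_hom]

text \<open>The value X^q at Y is forced: q = 0 and q + 1 = 1 in the field, so differentiating y^q +
  y = x^(q+1) gives dy = x^q dx. With it the curve polynomial is killed identically and not only at
  (x, y).\<close>

definition \<delta> :: "'k poly poly \<Rightarrow> 'k poly poly"
  where "\<delta> = total_deriv ([:0, 1:] ^ q)"

lemma \<delta>_add: "\<delta> (G + H) = \<delta> G + \<delta> H"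
  by (simp add: \<delta>_def total_deriv_add)

lemma \<delta>_mult: "\<delta> (G * H) = G * \<delta> H + H * \<delta> G"
  by (simp add: \<delta>_def total_deriv_mult)

lemma \<delta>_const: "\<delta> [:[:c:]:] = 0"
  by (simp add: \<delta>_def total_deriv_def map_poly_pCons)

lemma \<delta>_inner_var: "\<delta> [:[:0, 1:]:] = 1"
  by (simp add: \<delta>_def total_deriv_def map_poly_pCons pderiv_pCons flip: one_pCons)

lemma \<delta>_outer_var: "\<delta> [:0, 1:] = [:[:0, 1:]:] ^ q"
  by (simp add: \<delta>_def total_deriv_def map_poly_pCons pderiv_pCons poly_const_pow)

lemma of_nat_q_poly: "of_nat q = (0 :: 'k poly poly)"
  using n_ge_2 by (subst of_nat_eq_0_iff_char_dvd) (simp add: char_k)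

definition curve_poly :: "'k poly poly"
  where "curve_poly = [:0, 1:] ^ q + [:0, 1:] - [:[:0, 1:]:] ^ (q + 1)"

lemma ev_curve_poly: "ev curve_poly = 0"
  unfolding curve_poly_def ev_simps using curve_eq by simp

lemma \<delta>_curve_poly: "\<delta> curve_poly = 0"
proof -
  have "\<delta> curve_poly = [:[:0, 1:]:] ^ q - of_nat (q + 1) * [:[:0, 1:]:] ^ q"
    unfolding curve_poly_def additive_diff[of \<delta>, OF \<delta>_add] \<delta>_add
      derivation_power[of \<delta>, OF \<delta>_mult] \<delta>_outer_var \<delta>_inner_var of_nat_q_poly by simp
  also have "\<dots> = 0"
    using of_nat_q_poly by (simp del: of_nat_power add: algebra_simps)
  finally show ?thesis .
qed

lemma pderiv_curve_poly: "pderiv curve_poly = 1"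
proof -
  have "pderiv curve_poly = of_nat q * [:0, 1:] ^ (q - 1) * pderiv [:0, 1:] + pderiv [:0, 1:]
      - of_nat (q + 1) * [:[:0, 1:]:] ^ q * pderiv [:[:0, 1:]:]"
    unfolding curve_poly_def additive_diff[of pderiv, OF pderiv_add] pderiv_add
      derivation_power[of pderiv, OF pderiv_mult] by simp
  then show ?thesis
    by (simp only: of_nat_q_poly) (simp add: pderiv_pCons)
qed

text \<open>An element of least degree in \<open>Y\<close> among the nonzero relations between \<open>x\<close> and \<open>y\<close> divides every
  relation up to a factor from \<open>k[X]\<close>. Dividing the curve equation, which is separable in \<open>Y\<close>, shows
  that the \<open>\<delta>\<close>-derivative of this element vanishes.\<close>

lemma ev_\<delta>_eq_zero:
  assumes "ev G = 0"
  shows "ev (\<delta> G) = 0"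
proof -
  have "curve_poly \<noteq> 0"
    using pderiv_curve_poly by auto
  then obtain M where M: "M \<noteq> 0" "ev M = 0"
    and least: "\<And>H. H \<noteq> 0 \<Longrightarrow> ev H = 0 \<Longrightarrow> degree M \<le> degree H"
    using ex_has_least_nat[of "\<lambda>H. H \<noteq> 0 \<and> ev H = 0" curve_poly degree] ev_curve_poly by blast
  have divide: "\<exists>a Q. ev [:a:] \<noteq> 0 \<and> [:a:] * H = M * Q" if "ev H = 0" for H
  proof -
    \<comment> \<open>Since k[X] is not a field, division by \<open>M\<close> costs a factor
      \<open>a\<close> from k[X], which is nonzero at \<open>x\<close> by transcendence. The
      remainder is a relation of smaller degree in Y, hence 0.\<close>
    from pseudo_mod[OF M(1), of H] obtain a Q where aQ: "a \<noteq> 0"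
      "smult a H = M * Q + pseudo_mod H M"
      "pseudo_mod H M = 0 \<or> degree (pseudo_mod H M) < degree M"
      by blast
    have aH: "[:a:] * H = smult a H" by simp
    have "pseudo_mod H M = [:a:] * H - M * Q"
      using aQ(2) aH by simp
    then have "ev (pseudo_mod H M) = 0"
      using that M(2) by (simp only: ev_simps)  simp
    then have "pseudo_mod H M = 0"
      using aQ(3) least by fastforce
    moreover have "ev [:a:] \<noteq> 0"
      using x_transcendental aQ(1) by (auto simp: eval2_inner[OF emb_hom])
    ultimately show ?thesis
      using aQ(2) aH by auto
  qed
  obtain a Q where a: "ev [:a:] \<noteq> 0" and Q: "[:a:] * curve_poly = M * Q"
    using divide[OF ev_curve_poly] by blast
  \<comment> \<open>Apply the Leibniz rule to a * \<open>curve_poly\<close> = M * Q and evaluate: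
    every term containing \<open>curve_poly\<close>, its derivative, or \<open>M\<close> itself
    vanishes.\<close>
  have "ev Q * ev (\<delta> M) = 0"
  proof -
    have "ev (\<delta> ([:a:] * curve_poly)) = 0"
      by (simp only: \<delta>_mult \<delta>_curve_poly ev_simps ev_curve_poly) simp
    then show ?thesis
      by (simp only: Q \<delta>_mult ev_simps M(2)) simp
  qed
  \<comment> \<open>If \<open>Q\<close> vanished too, so would the Y-derivative of M * Q; but this
    derivative has the value a(x), because the curve polynomial has Y-derivative 1.\<close>
  moreover have "ev Q \<noteq> 0"
  proof
    assume "ev Q = 0"
    have "ev (pderiv ([:a:] * curve_poly)) = ev [:a:]"
      by (simp only: pderiv_mult pderiv_curve_poly ev_simps ev_curve_poly) simp
    moreover have "ev (pderiv (M * Q)) = 0"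
      by (simp only: pderiv_mult ev_simps M(2) \<open>ev Q = 0\<close>) simp
    ultimately show False
      using a Q by simp
  qed
  ultimately have \<delta>M: "ev (\<delta> M) = 0" by simp
  obtain c R where c: "ev [:c:] \<noteq> 0" and R: "[:c:] * G = M * R"
    using divide[OF assms] by blast
  have "ev (\<delta> ([:c:] * G)) = ev [:c:] * ev (\<delta> G)"
    by (simp only: \<delta>_mult ev_simps assms) simp
  moreover have "ev (\<delta> (M * R)) = 0"
    by (simp only: \<delta>_mult ev_simps M(2) \<delta>M) simp
  ultimately show ?thesis
    using c R by simp
qed

text \<open>The quotient rule for f = G/H, cleared of denominators; fractions have no preferred
  representation, hence the existential quantifier.\<close>

definition D0 :: "'F \<Rightarrow> 'F"
  where "D0 f = (THE z. \<exists>G H. ev H \<noteq> 0 \<and> ev G = f * ev H \<and> z * ev H = ev (\<delta> G) - f * ev (\<delta> H))"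

text \<open>Two representations G/H and G'/H' of \<open>f\<close> yield the relation G'H - GH'
  between \<open>x\<close> and \<open>y\<close>. By \<open>ev_\<delta>_eq_zero\<close> its
  derivative is a relation as well, which makes the two quotient-rule values agree.\<close>

lemma D0_eq:
  assumes "ev H \<noteq> 0" "ev G = f * ev H"
  shows "D0 f * ev H = ev (\<delta> G) - f * ev (\<delta> H)"
proof -
  have "D0 f = (ev (\<delta> G) - f * ev (\<delta> H)) / ev H"
    unfolding D0_def
  proof (rule the_equality)
    show "\<exists>G' H'. ev H' \<noteq> 0 \<and> ev G' = f * ev H' \<and>
        (ev (\<delta> G) - f * ev (\<delta> H)) / ev H * ev H' = ev (\<delta> G') - f * ev (\<delta> H')"
      using assms by (intro exI[of _ G] exI[of _ H]) simp
  next
    fix z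
    assume "\<exists>G' H'. ev H' \<noteq> 0 \<and> ev G' = f * ev H' \<and> z * ev H' = ev (\<delta> G') - f * ev (\<delta> H')"
    then obtain G' H' where *: "ev H' \<noteq> 0" "ev G' = f * ev H'"
      "z * ev H' = ev (\<delta> G') - f * ev (\<delta> H')" by blast
    have "ev (\<delta> (G' * H - G * H')) = 0"
      by (rule ev_\<delta>_eq_zero) (simp add: ev_simps *(2) assms(2))
    then have "f * ev H' * ev (\<delta> H) + ev H * ev (\<delta> G')
        = f * ev H * ev (\<delta> H') + ev H' * ev (\<delta> G)"
      by (simp add: additive_diff[of \<delta>, OF \<delta>_add] \<delta>_mult ev_simps *(2) assms(2))
    then have "ev H' * (ev (\<delta> G) - f * ev (\<delta> H)) = ev H * (ev (\<delta> G') - f * ev (\<delta> H'))"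
      by (simp add: algebra_simps)
    also have "\<dots> = ev H * (z * ev H')" using *(3) by simp
    finally have "ev (\<delta> G) - f * ev (\<delta> H) = z * ev H"
      using *(1) by (metis mult.left_commute mult.commute mult_left_cancel)
    then show "z = (ev (\<delta> G) - f * ev (\<delta> H)) / ev H"
      using assms(1) by simp
  qed
  then show ?thesis using assms(1) by simp
qed

lemma fraction_rep: "\<exists>G H. ev H \<noteq> 0 \<and> ev G = f * ev H"
  using generated[of f] by (metis nonzero_divide_eq_eq)

lemma D0_add: "D0 (f + g) = D0 f + D0 g"
proof -
  obtain G1 H1 G2 H2 where *: "ev H1 \<noteq> 0" "ev G1 = f * ev H1" "ev H2 \<noteq> 0" "ev G2 = g * ev H2"
    using fraction_rep by metis
  have e: "D0 (f + g) * ev (H1 * H2) = ev (\<delta> (G1 * H2 + G2 * H1)) - (f + g) * ev (\<delta> (H1 * H2))"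
    by (rule D0_eq) (use * in \<open>auto simp: ev_simps algebra_simps\<close>)
  have "D0 f * ev H1 = ev (\<delta> G1) - f * ev (\<delta> H1)" "D0 g * ev H2 = ev (\<delta> G2) - g * ev (\<delta> H2)"
    using * by (auto intro: D0_eq)
  then have e1: "ev (\<delta> G1) = D0 f * ev H1 + f * ev (\<delta> H1)"
    and e2: "ev (\<delta> G2) = D0 g * ev H2 + g * ev (\<delta> H2)" by simp_all
  have "D0 (f + g) * (ev H1 * ev H2) = (D0 f + D0 g) * (ev H1 * ev H2)"
    using e by (simp add: ev_simps \<delta>_add \<delta>_mult e1 e2 * algebra_simps)
  then show ?thesis using * by simp
qed

lemma D0_mult: "D0 (f * g) = f * D0 g + g * D0 f"
proof -
  obtain G1 H1 G2 H2 where *: "ev H1 \<noteq> 0" "ev G1 = f * ev H1" "ev H2 \<noteq> 0" "ev G2 = g * ev H2"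
    using fraction_rep by metis
  have e: "D0 (f * g) * ev (H1 * H2) = ev (\<delta> (G1 * G2)) - (f * g) * ev (\<delta> (H1 * H2))"
    by (rule D0_eq) (use * in \<open>auto simp: ev_simps algebra_simps\<close>)
  have "D0 f * ev H1 = ev (\<delta> G1) - f * ev (\<delta> H1)" "D0 g * ev H2 = ev (\<delta> G2) - g * ev (\<delta> H2)"
    using * by (auto intro: D0_eq)
  then have e1: "ev (\<delta> G1) = D0 f * ev H1 + f * ev (\<delta> H1)"
    and e2: "ev (\<delta> G2) = D0 g * ev H2 + g * ev (\<delta> H2)" by simp_all
  have "D0 (f * g) * (ev H1 * ev H2) = (f * D0 g + g * D0 f) * (ev H1 * ev H2)"
    using e by (simp add: ev_simps \<delta>_mult e1 e2 * algebra_simps)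
  then show ?thesis using * by simp
qed

lemma D0_emb: "D0 (emb c) = 0"
  using D0_eq[of 1 "[:[:c:]:]" "emb c"]
  by (simp add: ev_simps \<delta>_const derivation_one[of \<delta>, OF \<delta>_mult])

lemma D0_x: "D0 x = 1"
  using D0_eq[of 1 "[:[:0, 1:]:]" x]
  by (simp add: ev_simps \<delta>_inner_var derivation_one[of \<delta>, OF \<delta>_mult])

lemma D0_derivation: "D0 \<in> derivations"
  by (simp add: derivations_def D0_add D0_mult D0_emb)

end

subsection \<open>The Cartier operator\<close>

context hermitian_curve
begin

lemma frob_add: "(f + g) ^ p = f ^ p + (g :: 'F) ^ p"
  using freshmans_dream[where 'a='F] prime_p char_F by simp

lemma frob_diff: "(f - g) ^ p = f ^ p - (g :: 'F) ^ p"
  using additive_diff[of "\<lambda>f::'F. f ^ p", OF frob_add] .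

lemma frob_inj: "f ^ p = g ^ p \<Longrightarrow> f = (g :: 'F)"
  using frob_diff[of f g] by simp

lemma k_root: "\<exists>a :: 'k. a ^ p = c"
  using nth_root_exists[of p c] p_ge_2 by auto

lemma of_nat_p: "of_nat p = (0 :: 'F)"
  by (simp add: of_nat_F_eq_zero_iff)

lemma D0_frob: "D0 (f ^ p) = 0"
  by (simp add: derivation_power[of D0, OF D0_mult] of_nat_p)

text \<open>Applying \<open>D0\<close> turns a relation of length m + 1 into one of length m with
  coefficients (i+1) a_(i+1). The bound by \<open>p\<close> makes i + 1 invertible, so induction
  kills all a_i with i > 0, and the relation itself then kills a_0.\<close>

lemma D0_constants_independent:
  assumes "m \<le> p" "\<And>i. D0 (a i) = 0" "(\<Sum>i<m. a i * x ^ i) = 0" "i < m"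
  shows "a i = 0"
  using assms
proof (induction m arbitrary: a i)
  case (Suc m)
  have "D0 (a i * x ^ i) = of_nat i * a i * x ^ (i - 1)" for i
    by (simp add: D0_mult Suc.prems(2) derivation_power[of D0, OF D0_mult] D0_x)
  then have "0 = (\<Sum>i<Suc m. of_nat i * a i * x ^ (i - 1))"
    using arg_cong[OF Suc.prems(3), of D0]
    by (simp only: additive_sum[of D0, OF D0_add] additive_zero[of D0, OF D0_add])
  also have "\<dots> = (\<Sum>i<m. (of_nat (Suc i) * a (Suc i)) * x ^ i)"
    by (subst sum.lessThan_Suc_shift) (simp del: of_nat_Suc)
  finally have eq: "(\<Sum>i<m. (of_nat (Suc i) * a (Suc i)) * x ^ i) = 0" by simp
  have D0_nat: "D0 (of_nat j) = 0" for j
    using D0_emb[of "of_nat j"] by (simp add: emb_of_nat)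
  have "a (Suc j) = 0" if "j < m" for j
  proof -
    have "of_nat (Suc j) * a (Suc j) = 0"
      using Suc.IH[of "\<lambda>i. of_nat (Suc i) * a (Suc i)" j] eq that Suc.prems(1)
      by (simp add: D0_mult Suc.prems(2) D0_nat del: of_nat_Suc)
    moreover have "of_nat (Suc j) \<noteq> (0 :: 'F)"
      using that Suc.prems(1) by (simp add: of_nat_F_eq_zero_iff nat_dvd_not_less del: of_nat_Suc)
    ultimately show ?thesis by simp
  qed
  moreover from this have "a 0 = 0"
    using Suc.prems(3) by (subst (asm) sum.lessThan_Suc_shift) simp
  ultimately show ?case
    using Suc.prems(4) by (cases i) auto
qed simp

text \<open>Coordinates in the basis 1, x, ..., x^(p-1) over the subfield of p-th powers, recorded
  by their p-th roots. Values of \<open>g\<close> from index \<open>p\<close> on are arbitrary, so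
  uniqueness is only claimed below \<open>p\<close>.\<close>

definition has_coords :: "'F \<Rightarrow> (nat \<Rightarrow> 'F) \<Rightarrow> bool"
  where "has_coords f g \<longleftrightarrow> f = (\<Sum>i<p. g i ^ p * x ^ i)"

lemma coords_unique:
  assumes "has_coords f g" "has_coords f h" "i < p"
  shows "g i = h i"
proof -
  have "(\<Sum>i<p. (g i - h i) ^ p * x ^ i) = 0"
    using assms by (simp add: has_coords_def frob_diff left_diff_distrib sum_subtractf)
  then have "(g i - h i) ^ p = 0"
    using D0_constants_independent[of p "\<lambda>i. (g i - h i) ^ p" i] assms(3) by (simp add: D0_frob)
  then show ?thesis by simp
qed

lemma has_coords_add: "has_coords f g \<Longrightarrow> has_coords f' g' \<Longrightarrow> has_coords (f + f') (\<lambda>i. g i + g' i)"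
  by (simp add: has_coords_def frob_add distrib_right sum.distrib)

lemma has_coords_frob_mult: "has_coords f g \<Longrightarrow> has_coords (h ^ p * f) (\<lambda>i. h * g i)"
  by (simp add: has_coords_def power_mult_distrib sum_distrib_left mult.assoc)

text \<open>A cyclic shift: the overflowing term g_(p-1)^p x^p = (x g_(p-1))^p wraps round to index
  0.\<close>

lemma has_coords_x_mult:
  assumes "has_coords f g"
  shows "has_coords (x * f) (\<lambda>i. if i = 0 then x * g (p - 1) else g (i - 1))"
proof -
  obtain m where m: "p = Suc m" using p_ge_2 by (cases p) auto
  have "x * f = (\<Sum>i<m. g i ^ p * x ^ Suc i) + (x * g m) ^ p"
    using assms unfolding has_coords_def
    by (simp add: m sum_distrib_left distrib_left algebra_simps)
  also have "\<dots> = (\<Sum>i<Suc m. (if i = 0 then x * g m else g (i - 1)) ^ p * x ^ i)"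
    by (subst sum.lessThan_Suc_shift) simp
  finally have eq: "x * f = (\<Sum>i<Suc m. (if i = 0 then x * g m else g (i - 1)) ^ p * x ^ i)" .
  have "p - 1 = m" using m by simp
  show ?thesis
    unfolding has_coords_def \<open>p - 1 = m\<close> by (rule eq[folded m])
qed

lemma has_coords_x_power:
  assumes "m < p"
  shows "has_coords (x ^ m) (\<lambda>i. if i = m then 1 else 0)"
proof -
  have "(\<Sum>i<p. (if i = m then 1 else 0) ^ p * x ^ i) = (\<Sum>i<p. if i = m then x ^ i else 0)"
    using p_ge_2 by (intro sum.cong) auto
  then show ?thesis using assms by (simp add: has_coords_def)
qed

text \<open>Decomposable elements are not visibly closed under products, but the set
  \<open>M\<close> of multipliers that preserve decomposability is. It contains the p-th powers,
  hence the constants, and \<open>x\<close> by the cyclic shift.\<close>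

lemma has_coords_exists: "\<exists>g. has_coords f g"
proof -
  define M where "M = {m. \<forall>f. (\<exists>g. has_coords f g) \<longrightarrow> (\<exists>g. has_coords (m * f) g)}"
  have add: "m + m' \<in> M" if "m \<in> M" "m' \<in> M" for m m'
    using that has_coords_add by (fastforce simp: M_def distrib_right)
  have mult: "m * m' \<in> M" if "m \<in> M" "m' \<in> M" for m m'
    using that by (simp add: M_def mult.assoc)
  have frob: "m ^ p \<in> M" for m
    using has_coords_frob_mult by (auto simp: M_def)
  have emb: "emb c \<in> M" for c
    using k_root[of c] frob emb_power by metis
  have x: "x \<in> M"
    using has_coords_x_mult by (auto simp: M_def)
  have power: "m ^ j \<in> M" if "m \<in> M" for m j
    using that mult emb[of 1] by (induction j) (auto simp: emb_one)
  \<comment> \<open>The curve equation writes y as x^(q+1) minus the p-th power of y^(q/p).\<close>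
  have y: "y \<in> M"
  proof -
    obtain j where j: "n = Suc j" using n_ge_2 by (cases n) auto
    have "(y ^ p ^ j) ^ p = y ^ q"
      by (simp add: j mult.commute flip: power_mult)
    then have "y = x ^ (q + 1) + emb (- 1) * (y ^ p ^ j) ^ p"
      unfolding curve_eq[symmetric] by (simp add: emb_uminus emb_one)
    then show ?thesis
      using add[OF power[OF x] mult[OF emb frob]] by metis
  qed
  have ev: "ev G \<in> M" for G
    using eval2_mem[of emb M x y G, OF emb_hom] emb x y add mult by blast
  obtain G H where GH: "ev H \<noteq> 0" "f = ev G / ev H"
    using generated by blast
  \<comment> \<open>Denominators reduce to p-th powers: 1/H = (1/H)^p H^(p-1).\<close>
  have "ev H ^ p = ev H * ev H ^ (p - 1)"
    using p_ge_2 by (simp add: power_eq_if)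
  then have "f = (1 / ev H) ^ p * (ev H ^ (p - 1) * ev G)"
    using GH by (simp add: power_one_over field_simps)
  also have "\<dots> \<in> M"
    by (intro mult frob power ev)
  finally have "f \<in> M" .
  moreover have "\<exists>g. has_coords 1 g"
    using has_coords_x_power[of 0] p_ge_2 by auto
  ultimately have "\<exists>g. has_coords (f * 1) g"
    unfolding M_def by blast
  then show ?thesis by simp
qed

text \<open>The Cartier operator on coefficients of dx. The choice by \<open>SOME\<close> is
  harmless, since index p - 1 lies in the range where coordinates are unique.\<close>

definition cart :: "'F \<Rightarrow> 'F"
  where "cart f = (SOME g. has_coords f g) (p - 1)"

lemma cart_eqI: "has_coords f g \<Longrightarrow> cart f = g (p - 1)"
  unfolding cart_def using p_ge_2 by (intro coords_unique[of f]) (auto intro: someI[of "has_coords f"])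

lemma cart_add: "cart (f + f') = cart f + cart f'"
proof -
  obtain g g' where "has_coords f g" "has_coords f' g'"
    using has_coords_exists by metis
  from cart_eqI[OF has_coords_add[OF this]] this[THEN cart_eqI] show ?thesis by simp
qed

lemma cart_frob_mult: "cart (h ^ p * f) = h * cart f"
proof -
  obtain g where "has_coords f g"
    using has_coords_exists by metis
  from cart_eqI[OF has_coords_frob_mult[OF this]] cart_eqI[OF this] show ?thesis by simp
qed

text \<open>For p <= m <= 2p - 2 the power is x^p x^(m-p) with m - p <= p - 2, so it has no top
  coordinate. The bound covers exponents that are sums of two base-p digits.\<close>

lemma cart_x_power:
  assumes "m \<le> 2 * p - 2"
  shows "cart (x ^ m) = (if m = p - 1 then 1 else 0)"
proof (cases "m < p")
  case True
  then show ?thesis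
    using cart_eqI[OF has_coords_x_power[of m]] by auto
next
  case False
  then have "x ^ m = x ^ p * x ^ (m - p)"
    by (simp flip: power_add)
  then have "cart (x ^ m) = x * cart (x ^ (m - p))"
    by (simp only: cart_frob_mult)
  then show ?thesis
    using cart_eqI[OF has_coords_x_power[of "m - p"]] False assms p_ge_2 by auto
qed

text \<open>Differentiation sends g^p x^i with 0 < i < p to i g^p x^(i-1), whose exponent stays
  below p - 1.\<close>

lemma cart_D0: "cart (D0 f) = 0"
proof -
  obtain g where g: "has_coords f g"
    using has_coords_exists by blast
  have summand: "cart (D0 (g i ^ p * x ^ i)) = 0" if "i < p" for i
  proof -
    \<comment> \<open>The factor i has to be a p-th power in order to pass through
      \<open>cart_frob_mult\<close>; perfectness of the constants supplies the root.\<close>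
    obtain a where "a ^ p = (of_nat i :: 'k)"
      using k_root by blast
    then have a: "of_nat i = emb a ^ p"
      by (metis emb_of_nat emb_power)
    have "D0 (g i ^ p * x ^ i) = (g i * emb a) ^ p * x ^ (i - 1)"
      by (simp add: D0_mult of_nat_p derivation_power[of D0, OF D0_mult] D0_x a power_mult_distrib)
    then have "cart (D0 (g i ^ p * x ^ i)) = g i * emb a * cart (x ^ (i - 1))"
      by (simp only: cart_frob_mult)
    moreover have "emb a * cart (x ^ (i - 1)) = 0"
    proof (cases "i = 0")
      case True
      with a have "emb a ^ p = 0" by simp
      then show ?thesis by simp
    next
      case False
      with that p_ge_2 show ?thesis by (simp add: cart_x_power)
    qed
    ultimately show ?thesis by simp
  qed
  have "cart (D0 f) = (\<Sum>i<p. cart (D0 (g i ^ p * x ^ i)))"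
    using g by (simp add: has_coords_def additive_sum[of D0, OF D0_add] additive_sum[of cart, OF cart_add])
  then show ?thesis using summand by simp
qed

text \<open>Differentials are functionals on derivations, so evaluation at \<open>D0\<close>
  recovers the coefficient of dx.\<close>

lemma scaleD_d_apply: "scaleD f (d x) D0 = f"
  by (simp add: scaleD_def d_def D0_derivation D0_x)

lemma scaleD_dx_inj: "scaleD f (d x) = scaleD g (d x) \<longleftrightarrow> f = g"
  using scaleD_d_apply by metis

lemma cartier_scaleD: "cartier (scaleD f (d x)) = scaleD (cart f) (d x)"
  unfolding cartier_def
proof (rule the_equality)
  obtain g where g: "has_coords f g"
    using has_coords_exists by blast
  then show "\<exists>h. scaleD f (d x) = scaleD (\<Sum>i<p. h i ^ p * x ^ i) (d x) \<and>
      scaleD (cart f) (d x) = scaleD (h (p - 1)) (d x)"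
    using cart_eqI[OF g] by (auto simp: has_coords_def)
next
  fix \<omega>
  assume "\<exists>h. scaleD f (d x) = scaleD (\<Sum>i<p. h i ^ p * x ^ i) (d x) \<and>
      \<omega> = scaleD (h (p - 1)) (d x)"
  then show "\<omega> = scaleD (cart f) (d x)"
    using cart_eqI[of f] by (auto simp: scaleD_dx_inj has_coords_def)
qed

text \<open>Every derivation is a multiple of \<open>D0\<close>: it kills the p-th powers in the
  coordinate expansion of \<open>f\<close> and is thus determined by its value at
  \<open>x\<close>.\<close>

lemma d_eq: "d f = scaleD (D0 f) (d x)"
proof
  fix D
  show "d f D = scaleD (D0 f) (d x) D"
  proof (cases "D \<in> derivations")
    case True
    then have D: "D (f + g) = D f + D g" "D (f * g) = f * D g + g * D f" "D (emb c) = 0" for f g c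
      by (auto simp: derivations_def)
    obtain g where g: "has_coords f g"
      using has_coords_exists by blast
    have "D f = (\<Sum>i<p. g i ^ p * (of_nat i * x ^ (i - 1))) * D x"
      using g unfolding has_coords_def
      by (simp add: additive_sum[of D, OF D(1)] D(2) of_nat_p derivation_power[of D, OF D(2)]
          sum_distrib_right mult.assoc)
    moreover have "D0 f = (\<Sum>i<p. g i ^ p * (of_nat i * x ^ (i - 1)))"
      using g unfolding has_coords_def
      by (simp add: additive_sum[of D0, OF D0_add] D0_mult of_nat_p
          derivation_power[of D0, OF D0_mult] D0_x)
    ultimately show ?thesis
      using True by (simp add: d_def scaleD_def)
  qed (simp add: d_def scaleD_def)
qed

lemma scaleD_add: "scaleD (f + g) \<omega> = scaleD f \<omega> + scaleD g (\<omega> :: 'F differential)"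
  by (simp add: scaleD_def fun_eq_iff distrib_right)

lemma scaleD_scaleD: "scaleD f (scaleD g \<omega>) = scaleD (f * g) (\<omega> :: 'F differential)"
  by (simp add: scaleD_def mult.assoc)

lemma scaleD_uminus: "scaleD (- f) \<omega> = - scaleD f (\<omega> :: 'F differential)"
  by (simp add: scaleD_def fun_eq_iff)

lemma scaleD_diff: "scaleD (f - g) \<omega> = scaleD f \<omega> - scaleD g (\<omega> :: 'F differential)"
  by (simp add: scaleD_def fun_eq_iff left_diff_distrib)

lemma scaleD_zero: "scaleD 0 \<omega> = (0 :: 'F differential)"
  by (simp add: scaleD_def fun_eq_iff)

lemma scaleD_one: "scaleD 1 \<omega> = (\<omega> :: 'F differential)"
  by (simp add: scaleD_def)

lemma scaleD_right_distrib: "scaleD f (\<omega> + \<omega>') = scaleD f \<omega> + scaleD f (\<omega>' :: 'F differential)"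
  by (simp add: scaleD_def fun_eq_iff distrib_left)

lemma scaleD_right_diff: "scaleD f (\<omega> - \<omega>') = scaleD f \<omega> - scaleD f (\<omega>' :: 'F differential)"
  by (simp add: scaleD_def fun_eq_iff right_diff_distrib)

lemma D0_y: "D0 y = x ^ q"
proof -
  have "D0 (y ^ q + y) = D0 (x ^ (q + 1))"
    by (simp only: curve_eq)
  then have "of_nat q * y ^ (q - 1) * D0 y + D0 y = of_nat (q + 1) * x ^ q"
    by (simp only: D0_add derivation_power[of D0, OF D0_mult] D0_x) simp
  then show ?thesis
    using of_nat_q by (simp del: of_nat_power)
qed

end

subsection \<open>Regular functions and regular differentials\<close>

context hermitian_curve
begin

lemmas id_hom = refl[of "_ + _ :: 'k"] refl[of "_ * _ :: 'k"] refl[of "1 :: 'k"]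

lemma local_ringI:
  assumes "eval2 (\<lambda>c. c) H a b \<noteq> 0"
  shows "eval2 emb G u v / eval2 emb H u v \<in> chart_local_ring u v a b"
  using assms by (auto simp: chart_local_ring_def)

lemma chart_local_ring_eval2: "eval2 emb G u v \<in> chart_local_ring u v a b"
  using local_ringI[of 1 a b G u v]
  by (simp add: eval2_one[OF id_hom] eval2_one[OF emb_hom])

lemma chart_local_ring_add:
  assumes "f \<in> chart_local_ring u v a b" "g \<in> chart_local_ring u v a b"
  shows "f + g \<in> chart_local_ring u v a b"
proof -
  obtain G1 H1 G2 H2 where
    f: "f = eval2 emb G1 u v / eval2 emb H1 u v" "eval2 (\<lambda>c. c) H1 a b \<noteq> 0" and
    g: "g = eval2 emb G2 u v / eval2 emb H2 u v" "eval2 (\<lambda>c. c) H2 a b \<noteq> 0"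
    using assms by (auto simp: chart_local_ring_def)
  show ?thesis
  \<comment> \<open>The local ring only asks for a denominator that is nonzero at the point. If it
    is 0 in the function field, the fraction is 0 by convention and the sum is the other
    summand.\<close>
  proof (cases "eval2 emb H1 u v = 0 \<or> eval2 emb H2 u v = 0")
    case True
    then show ?thesis using assms f(1) g(1) by auto
  next
    case False
    then have "f + g = eval2 emb (G1 * H2 + G2 * H1) u v / eval2 emb (H1 * H2) u v"
      by (simp add: f g eval2_add[OF emb_hom] eval2_mult[OF emb_hom] field_simps)
    also have "\<dots> \<in> chart_local_ring u v a b"
      by (rule local_ringI) (simp add: eval2_mult[OF id_hom] f g)
    finally show ?thesis .
  qed
qed

lemma chart_local_ring_mult:
  assumes "f \<in> chart_local_ring u v a b" "g \<in> chart_local_ring u v a b"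
  shows "f * g \<in> chart_local_ring u v a b"
proof -
  obtain G1 H1 G2 H2 where
    f: "f = eval2 emb G1 u v / eval2 emb H1 u v" "eval2 (\<lambda>c. c) H1 a b \<noteq> 0" and
    g: "g = eval2 emb G2 u v / eval2 emb H2 u v" "eval2 (\<lambda>c. c) H2 a b \<noteq> 0"
    using assms by (auto simp: chart_local_ring_def)
  have "f * g = eval2 emb (G1 * G2) u v / eval2 emb (H1 * H2) u v"
    by (simp add: f g eval2_mult[OF emb_hom])
  also have "\<dots> \<in> chart_local_ring u v a b"
    by (rule local_ringI) (simp add: eval2_mult[OF id_hom] f g)
  finally show ?thesis .
qed

lemma local_ring_add: "f \<in> local_ring P \<Longrightarrow> g \<in> local_ring P \<Longrightarrow> f + g \<in> local_ring P"
  by (cases P) (auto intro: chart_local_ring_add)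

lemma local_ring_mult: "f \<in> local_ring P \<Longrightarrow> g \<in> local_ring P \<Longrightarrow> f * g \<in> local_ring P"
  by (cases P) (auto intro: chart_local_ring_mult)

lemma local_ring_emb: "emb c \<in> local_ring P"
  using chart_local_ring_eval2[of "[:[:c:]:]"]
  by (cases P) (simp_all add: eval2_const[OF emb_hom])

lemma local_ring_one: "1 \<in> local_ring P"
  using local_ring_emb[of 1] by (simp add: emb_one)

lemma local_ring_zero: "0 \<in> local_ring P"
  using local_ring_emb[of 0] by (simp add: emb_zero)

lemma local_ring_uminus: "f \<in> local_ring P \<Longrightarrow> - f \<in> local_ring P"
  using local_ring_mult[OF local_ring_emb[of "- 1"], of f] by (simp add: emb_uminus emb_one)

lemma local_ring_diff: "f \<in> local_ring P \<Longrightarrow> g \<in> local_ring P \<Longrightarrow> f - g \<in> local_ring P"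
  using local_ring_add[OF _ local_ring_uminus] by fastforce

lemma local_ring_power: "f \<in> local_ring P \<Longrightarrow> f ^ m \<in> local_ring P"
  by (induction m) (auto intro: local_ring_mult local_ring_one)

lemma local_ring_sum: "(\<And>i. i \<in> A \<Longrightarrow> f i \<in> local_ring P) \<Longrightarrow> sum f A \<in> local_ring P"
  by (induction A rule: infinite_finite_induct) (auto intro: local_ring_add local_ring_zero)

lemma local_ring_affine_x: "x \<in> local_ring (Affine a b)"
  using chart_local_ring_eval2[of "[:[:0, 1:]:]" x y a b]
  by (simp add: eval2_inner_var[OF emb_hom])

lemma local_ring_affine_y: "y \<in> local_ring (Affine a b)"
  using chart_local_ring_eval2[of "[:0, 1:]" x y a b]
  by (simp add: eval2_outer_var[OF emb_hom])

lemma local_ring_affine_inverse_x: "a \<noteq> 0 \<Longrightarrow> 1 / x \<in> local_ring (Affine a b)"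
  using local_ringI[of "[:[:0, 1:]:]" a b 1 x y]
  by (simp add: eval2_inner_var[OF emb_hom] eval2_one[OF emb_hom] eval2_inner_var[OF id_hom])

lemma local_ring_infty_u: "x / y \<in> local_ring Infty"
  using chart_local_ring_eval2[of "[:[:0, 1:]:]" "x / y" "1 / y" 0 0]
  by (simp add: eval2_inner_var[OF emb_hom])

lemma local_ring_infty_w: "1 / y \<in> local_ring Infty"
  using chart_local_ring_eval2[of "[:0, 1:]" "x / y" "1 / y" 0 0]
  by (simp add: eval2_outer_var[OF emb_hom])

declare local_ring.simps [simp del]

lemma q_ge_4: "q \<ge> 4"
proof -
  have "(2::nat) ^ 2 \<le> p ^ 2" using p_ge_2 by (intro power_mono) auto
  also have "\<dots> \<le> q" using p_ge_2 n_ge_2 by (intro power_increasing) auto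
  finally show ?thesis by simp
qed

text \<open>With \<open>u = x/y\<close> and \<open>w = 1/y\<close> the curve equation reads \<open>w (1 + w^(q-1)) = u^(q+1)\<close>, so that
  \<open>u\<close> is a uniformizer at the point at infinity.\<close>

lemma infty_unit: "\<exists>e \<in> local_ring Infty. 1 / y = (x / y) ^ (q + 1) * e"
proof -
  define H :: "'k poly poly" where "H = 1 + [:0, 1:] ^ (q - 1)"
  have evH: "eval2 emb H (x / y) (1 / y) = 1 + (1 / y) ^ (q - 1)"
    by (simp add: H_def eval2_add[OF emb_hom] eval2_power[OF emb_hom] eval2_one[OF emb_hom]
        eval2_outer_var[OF emb_hom] del: power_one_over)
  have "eval2 (\<lambda>c. c) H 0 0 = 1"
    using q_ge_4 by (simp add: H_def eval2_add[OF id_hom] eval2_power[OF id_hom]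
        eval2_one[OF id_hom] eval2_outer_var[OF id_hom])
  then have e: "1 / (1 + (1 / y) ^ (q - 1)) \<in> local_ring Infty"
    using local_ringI[of H 0 0 1 "x / y" "1 / y"]
    by (simp add: evH eval2_one[OF emb_hom] local_ring.simps del: power_one_over)
  have yq: "y ^ q = y * y ^ (q - 1)"
    using power_minus_mult[OF q_pos, of y] by (metis mult.commute)
  have "1 / y * (1 + (1 / y) ^ (q - 1)) = (y ^ q + y) / y ^ (q + 1)"
    using y_nonzero by (simp add: yq field_simps)
  then have eq: "1 / y * (1 + (1 / y) ^ (q - 1)) = (x / y) ^ (q + 1)"
    by (simp only: curve_eq power_divide)
  moreover from this have "1 + (1 / y) ^ (q - 1) \<noteq> 0"
    using x_nonzero y_nonzero by (metis divide_eq_0_iff mult_zero_right power_not_zero)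
  ultimately have "1 / y = (x / y) ^ (q + 1) * (1 / (1 + (1 / y) ^ (q - 1)))"
    by (metis mult.right_neutral nonzero_eq_divide_eq times_divide_eq_right)
  with e show ?thesis by blast
qed

text \<open>At infinity \<open>x\<close> has pole order q and \<open>y\<close> has pole order q + 1,
  so the hypothesis says that y^b / x^a has nonnegative order. With u = x/y, 1/y = u^(q+1) e and a =
  b + l, the function is u^K e^l where K = (q+1) l - a = q l - b.\<close>

lemma local_ring_infty_monomial:
  assumes "(q + 1) * b \<le> q * a"
  shows "y ^ b / x ^ a \<in> local_ring Infty"
proof -
  obtain e where e: "e \<in> local_ring Infty" "1 / y = (x / y) ^ (q + 1) * e"
    using infty_unit by blast
  have "q * b \<le> (q + 1) * b" by simp
  also note assms
  finally have "b \<le> a" by (rule nat_mult_le_cancel1[OF q_pos, THEN iffD1])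
  then obtain l where a: "a = b + l" using le_Suc_ex by blast
  define K where "K = q * l - b"
  have K: "K + a = (q + 1) * l"
    using assms by (simp add: K_def a algebra_simps)
  have "(x / y) ^ a * ((x / y) ^ K * e ^ l) = (1 / y) ^ l"
    by (simp only: e(2) power_mult_distrib K power_mult flip: power_add mult.assoc add.commute[of K])
  then have "y ^ b / x ^ a = (x / y) ^ K * e ^ l"
    using x_nonzero y_nonzero by (simp add: field_simps a power_add)
  then show ?thesis
    using e(1) by (auto intro!: local_ring_mult local_ring_power local_ring_infty_u)
qed

lemma U1_cases:
  assumes "P \<in> U1"
  obtains a b where "P = Affine a b"
  using assms by (cases P) (auto simp: U1_def)

lemma U2_cases:
  assumes "P \<in> U2"
  obtains a b where "P = Affine a b" "a \<noteq> 0" | "P = Infty"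
  using assms by (cases P) (auto simp: U2_def curve_def)

lemma origin_in_U1: "Affine 0 0 \<in> U1"
  using q_pos by (auto simp: U1_def curve_def)

lemma infty_in_U2: "Infty \<in> U2"
  by (auto simp: U2_def curve_def)

lemma regular_add: "f \<in> regular U \<Longrightarrow> g \<in> regular U \<Longrightarrow> f + g \<in> regular U"
  by (auto simp: regular_def intro: local_ring_add)

lemma regular_mult: "f \<in> regular U \<Longrightarrow> g \<in> regular U \<Longrightarrow> f * g \<in> regular U"
  by (auto simp: regular_def intro: local_ring_mult)

lemma regular_diff: "f \<in> regular U \<Longrightarrow> g \<in> regular U \<Longrightarrow> f - g \<in> regular U"
  by (auto simp: regular_def intro: local_ring_diff)

lemma regular_uminus: "f \<in> regular U \<Longrightarrow> - f \<in> regular U"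
  by (auto simp: regular_def intro: local_ring_uminus)

lemma regular_power: "f \<in> regular U \<Longrightarrow> f ^ m \<in> regular U"
  by (auto simp: regular_def intro: local_ring_power)

lemma regular_emb: "emb c \<in> regular U"
  by (auto simp: regular_def intro: local_ring_emb)

lemma regular_zero: "0 \<in> regular U"
  by (auto simp: regular_def intro: local_ring_zero)

lemma regular_sum: "(\<And>i. i \<in> A \<Longrightarrow> f i \<in> regular U) \<Longrightarrow> sum f A \<in> regular U"
  by (auto simp: regular_def intro: local_ring_sum)

lemma regular_mono: "U \<subseteq> U' \<Longrightarrow> f \<in> regular U' \<Longrightarrow> f \<in> regular U"
  by (auto simp: regular_def)

lemma local_ring_affine_monomial: "a \<noteq> 0 \<Longrightarrow> y ^ j / x ^ i \<in> local_ring (Affine a b)"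
  using local_ring_mult[OF local_ring_power[OF local_ring_affine_y]
      local_ring_power[OF local_ring_affine_inverse_x]]
  by (simp add: power_one_over)

lemma regular_U1_monomial: "x ^ i * y ^ j \<in> regular U1"
  unfolding regular_def
  by (auto elim!: U1_cases
      intro!: local_ring_mult local_ring_power local_ring_affine_x local_ring_affine_y)

lemma regular_U12_monomial: "y ^ j / x ^ i \<in> regular (U1 \<inter> U2)"
  unfolding regular_def
  by (auto elim!: U2_cases simp: U1_def intro: local_ring_affine_monomial)

lemma regular_U2_monomial: "(q + 1) * j \<le> q * i \<Longrightarrow> y ^ j / x ^ i \<in> regular U2"
  unfolding regular_def
  by (auto elim!: U2_cases
      intro: local_ring_affine_monomial local_ring_infty_monomial)

section \<open>Regular differentials and their order at infinity\<close>

definition forms_at :: "'k point \<Rightarrow> 'F differential set"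
  where "forms_at P = {\<omega>. \<exists>(m::nat) f g. (\<forall>i<m. f i \<in> local_ring P \<and> g i \<in> local_ring P) \<and>
    \<omega> = (\<Sum>i<m. scaleD (f i) (d (g i)))}"

lemma regular_forms_eq: "regular_forms U = {\<omega>. \<forall>P\<in>U. \<omega> \<in> forms_at P}"
  by (simp add: regular_forms_def forms_at_def)

lemma forms_atE:
  assumes "\<omega> \<in> forms_at P"
  obtains m f g where "\<forall>i<(m::nat). f i \<in> local_ring P \<and> g i \<in> local_ring P"
    "\<omega> = (\<Sum>i<m. scaleD (f i) (d (g i)))"
  using assms unfolding forms_at_def by (elim CollectE exE conjE) (rule that)

lemma forms_atI: "f \<in> local_ring P \<Longrightarrow> g \<in> local_ring P \<Longrightarrow> scaleD f (d g) \<in> forms_at P"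
  unfolding forms_at_def
  by (intro CollectI exI[of _ "1 :: nat"] exI[of _ "\<lambda>_. f"] exI[of _ "\<lambda>_. g"]) simp

lemma forms_at_add:
  assumes "\<omega> \<in> forms_at P" "\<omega>' \<in> forms_at P"
  shows "\<omega> + \<omega>' \<in> forms_at P"
  using assms(1)
proof (rule forms_atE)
  fix m :: nat and f g
  assume 1: "\<forall>i<m. f i \<in> local_ring P \<and> g i \<in> local_ring P" "\<omega> = (\<Sum>i<m. scaleD (f i) (d (g i)))"
  from assms(2) show ?thesis
  proof (rule forms_atE)
    fix m' :: nat and f' g'
    assume 2: "\<forall>i<m'. f' i \<in> local_ring P \<and> g' i \<in> local_ring P"
      "\<omega>' = (\<Sum>i<m'. scaleD (f' i) (d (g' i)))"
    define f'' where "f'' i = (if i < m then f i else f' (i - m))" for i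
    define g'' where "g'' i = (if i < m then g i else g' (i - m))" for i
    have split: "(\<Sum>i<m + k. h i) = (\<Sum>i<m. h i) + (\<Sum>i<k. h (m + i))"
      for h :: "nat \<Rightarrow> 'F differential" and k
      by (induction k) (auto simp: add.assoc)
    have "\<omega> + \<omega>' = (\<Sum>i<m + m'. scaleD (f'' i) (d (g'' i)))"
      unfolding 1 2 split by (simp add: f''_def g''_def)
    moreover have "\<forall>i<m + m'. f'' i \<in> local_ring P \<and> g'' i \<in> local_ring P"
      using 1 2 by (auto simp: f''_def g''_def)
    ultimately show ?thesis
      unfolding forms_at_def by blast
  qed
qed

lemma forms_at_scaleD:
  assumes "\<omega> \<in> forms_at P" "h \<in> local_ring P"
  shows "scaleD h \<omega> \<in> forms_at P"
  using assms(1)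
proof (rule forms_atE)
  fix m :: nat and f g
  assume 1: "\<forall>i<m. f i \<in> local_ring P \<and> g i \<in> local_ring P" "\<omega> = (\<Sum>i<m. scaleD (f i) (d (g i)))"
  have "scaleD h \<omega> = (\<Sum>i<m. scaleD (h * f i) (d (g i)))"
    unfolding 1 additive_sum[of "scaleD h", OF scaleD_right_distrib] scaleD_scaleD ..
  then show ?thesis
    unfolding forms_at_def using 1 assms(2)
    by (intro CollectI exI[of _ m] exI[of _ "\<lambda>i. h * f i"] exI[of _ g]) (auto intro: local_ring_mult)
qed

lemma forms_at_dx:
  assumes "\<omega> \<in> forms_at P"
  shows "\<exists>f. \<omega> = scaleD f (d x)"
  using assms
proof (rule forms_atE)
  fix m :: nat and f g
  assume "\<omega> = (\<Sum>i<m. scaleD (f i) (d (g i)))"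
  also have "\<dots> = (\<Sum>i<m. scaleD (f i * D0 (g i)) (d x))"
    by (simp add: d_eq[of "g _"] scaleD_scaleD)
  also have "\<dots> = scaleD (\<Sum>i<m. f i * D0 (g i)) (d x)"
    by (rule additive_sum[of "\<lambda>f. scaleD f (d x)", OF scaleD_add, symmetric])
  finally show ?thesis by blast
qed

text \<open>The quotient rule and the curve equation give d(x/y) = - y^(q-2) dx, and x/y is regular
  at infinity. So dx absorbs q - 2 factors \<open>y\<close>, a zero of order (q+1)(q-2).\<close>

lemma scaleD_dx_at_infty:
  assumes "f * (1 / y) ^ (q - 2) \<in> local_ring Infty"
  shows "scaleD f (d x) \<in> forms_at Infty"
proof -
  have yq: "y ^ q = y * y * y ^ (q - 2)"
  proof -
    have "q = 2 + (q - 2)" using q_ge_4 by simp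
    then have "y ^ q = y ^ 2 * y ^ (q - 2)" by (metis power_add)
    then show ?thesis by (simp add: power2_eq_square)
  qed
  have "D0 (x / y * y) = x / y * D0 y + y * D0 (x / y)"
    by (rule D0_mult)
  then have "y = x * x ^ q + D0 (x / y) * y * y"
    using y_nonzero by (simp add: D0_x D0_y field_simps)
  moreover have "x * x ^ q = y ^ q + y"
    using curve_eq by simp
  ultimately have "D0 (x / y) * y * y = - (y ^ q)"
    by (simp add: algebra_simps eq_neg_iff_add_eq_0)
  then have "y * y * (D0 (x / y) + y ^ (q - 2)) = 0"
    by (simp add: yq algebra_simps)
  then have "D0 (x / y) = - (y ^ (q - 2))"
    using y_nonzero by (simp add: eq_neg_iff_add_eq_0)
  then have "scaleD f (d x) = scaleD (- (f * (1 / y) ^ (q - 2))) (d (x / y))"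
    using y_nonzero by (simp add: d_eq[of "x / y"] scaleD_scaleD power_one_over)
  then show ?thesis
    using assms by (auto intro!: forms_atI local_ring_uminus local_ring_infty_u)
qed

lemma scaleD_dx_at_affine: "f \<in> local_ring (Affine a b) \<Longrightarrow> scaleD f (d x) \<in> forms_at (Affine a b)"
  using local_ring_affine_x by (intro forms_atI)

lemma regular_forms_U1_monomial: "scaleD (x ^ i * y ^ j) (d x) \<in> regular_forms U1"
  unfolding regular_forms_eq
  by (auto elim!: U1_cases intro!: scaleD_dx_at_affine
      local_ring_mult local_ring_power local_ring_affine_x local_ring_affine_y)

text \<open>Relative to d(x/y) the coefficient is, up to sign, (x/y)^i (1/y)^(q-2-i-j); the bound
  defining \<open>\<Delta>\<close> makes the last exponent nonnegative.\<close>

lemma regular_forms_U2_holomorphic: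
  assumes "i + j \<le> q - 2"
  shows "scaleD (x ^ i * y ^ j) (d x) \<in> regular_forms U2"
proof -
  obtain l where l: "q - 2 = i + j + l"
    using assms le_Suc_ex by blast
  have "x ^ i * y ^ j * (1 / y) ^ (q - 2) = (x / y) ^ i * (1 / y) ^ l"
    unfolding l using y_nonzero by (simp add: field_simps power_add)
  then have "x ^ i * y ^ j * (1 / y) ^ (q - 2) \<in> local_ring Infty"
    by (metis local_ring_mult local_ring_power local_ring_infty_u local_ring_infty_w)
  then show ?thesis
    unfolding regular_forms_eq
    by (auto elim!: U2_cases
        intro!: scaleD_dx_at_affine scaleD_dx_at_infty
        local_ring_mult local_ring_power local_ring_affine_x local_ring_affine_y)
qed

text \<open>The hypothesis is nonnegativity of the order at infinity, to which dx contributes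
  (q+1)(q-2). If j < q - 2 a power of 1/y is left over; otherwise
  \<open>local_ring_infty_monomial\<close> treats what remains of y^j.\<close>

lemma regular_forms_U2_monomial:
  assumes "(q + 1) * j \<le> q * i + (q + 1) * (q - 2)"
  shows "scaleD (y ^ j / x ^ i) (d x) \<in> regular_forms U2"
proof -
  have "y ^ j / x ^ i * (1 / y) ^ (q - 2) \<in> local_ring Infty"
  proof (cases "j \<ge> q - 2")
    case True
    then obtain l where l: "j = (q - 2) + l"
      using le_Suc_ex by blast
    have "(q + 1) * l \<le> q * i"
      using assms by (simp add: l distrib_left)
    then have "y ^ l / x ^ i \<in> local_ring Infty"
      by (rule local_ring_infty_monomial)
    moreover have "y ^ j / x ^ i * (1 / y) ^ (q - 2) = y ^ l / x ^ i"
      unfolding l using y_nonzero x_nonzero by (simp add: field_simps power_add)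
    ultimately show ?thesis by (simp only:)
  next
    case False
    then obtain l where l: "q - 2 = j + l"
      using le_Suc_ex nat_le_linear by blast
    have "y ^ j / x ^ i * (1 / y) ^ (q - 2) = (1 / y) ^ l * (y ^ 0 / x ^ i)"
      unfolding l using y_nonzero x_nonzero by (simp add: field_simps power_add)
    also have "\<dots> \<in> local_ring Infty"
      by (intro local_ring_mult local_ring_power local_ring_infty_w local_ring_infty_monomial) simp
    finally show ?thesis .
  qed
  then show ?thesis
    unfolding regular_forms_eq
    by (auto elim!: U2_cases
        intro!: scaleD_dx_at_affine scaleD_dx_at_infty local_ring_affine_monomial)
qed

lemma regular_forms_add:
  "\<omega> \<in> regular_forms U \<Longrightarrow> \<omega>' \<in> regular_forms U \<Longrightarrow> \<omega> + \<omega>' \<in> regular_forms U"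
  by (auto simp: regular_forms_eq intro: forms_at_add)

lemma regular_forms_scaleD:
  "\<omega> \<in> regular_forms U \<Longrightarrow> f \<in> regular U \<Longrightarrow> scaleD f \<omega> \<in> regular_forms U"
  by (auto simp: regular_forms_eq regular_def intro: forms_at_scaleD)

lemma regular_forms_d: "f \<in> regular U \<Longrightarrow> d f \<in> regular_forms U"
  using forms_atI[OF local_ring_one] by (auto simp: regular_forms_eq regular_def scaleD_one)

lemma regular_forms_zero: "0 \<in> regular_forms U"
  unfolding regular_forms_def by (auto intro!: exI[of _ 0])

lemma d_add: "d (f + g) = d f + d g"
  by (simp add: d_eq[of "_ + _"] d_eq[of f] d_eq[of g] D0_add scaleD_add)

lemma d_emb_mult: "d (emb c * f) = scaleD (emb c) (d f)"
  by (simp add: d_eq[of "_ * _"] d_eq[of f] D0_mult D0_emb scaleD_scaleD)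

lemma d_frob: "d (f ^ p) = 0"
  by (simp add: d_eq[of "_ ^ _"] D0_frob scaleD_zero)

lemma d_zero: "d 0 = 0"
  using additive_zero[of d, OF d_add] .

lemma d_uminus: "d (- f) = - d f"
  using additive_uminus[of d, OF d_add] .

lemma d_diff: "d (f - g) = d f - d g"
  using additive_diff[of d, OF d_add] .

subsection \<open>Cocycles and coboundaries\<close>

lemma scaleD_right_zero: "scaleD f 0 = (0 :: 'F differential)"
  by (simp add: scaleD_def fun_eq_iff)

lemma cocycles_add: "s \<in> cocycles \<Longrightarrow> t \<in> cocycles \<Longrightarrow> s + t \<in> cocycles"
  by (auto simp: cocycles_def d_add intro: regular_add regular_forms_add)

lemma cocycles_scale: "t \<in> cocycles \<Longrightarrow> scale_triple c t \<in> cocycles"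
  by (auto simp: cocycles_def d_emb_mult scaleD_right_diff
      intro!: regular_mult regular_emb regular_forms_scaleD)

lemma coboundaries_subset_cocycles: "coboundaries \<subseteq> cocycles"
  by (auto simp: coboundaries_def cocycles_def d_diff
      intro: regular_diff regular_forms_d regular_mono[of "U1 \<inter> U2"])

lemma coboundaryI:
  "\<kappa>1 \<in> regular U1 \<Longrightarrow> \<kappa>2 \<in> regular U2 \<Longrightarrow> (\<kappa>1 - \<kappa>2, d \<kappa>1, d \<kappa>2) \<in> coboundaries"
  by (auto simp: coboundaries_def)

lemma coboundaries_zero: "0 \<in> coboundaries"
  using coboundaryI[OF regular_zero regular_zero] by (simp add: d_zero zero_prod_def)

lemma coboundaries_add:
  assumes "s \<in> coboundaries" "t \<in> coboundaries"
  shows "s + t \<in> coboundaries"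
proof -
  obtain a b a' b' where "s = (a - b, d a, d b)" "t = (a' - b', d a', d b')"
    and r: "a \<in> regular U1" "b \<in> regular U2" "a' \<in> regular U1" "b' \<in> regular U2"
    using assms unfolding coboundaries_def by blast
  then have "s + t = ((a + a') - (b + b'), d (a + a'), d (b + b'))"
    by (simp add: d_add)
  then show ?thesis
    using r by (simp add: coboundaryI regular_add)
qed

lemma coboundaries_scale:
  assumes "t \<in> coboundaries"
  shows "scale_triple c t \<in> coboundaries"
proof -
  obtain a b where "t = (a - b, d a, d b)" and r: "a \<in> regular U1" "b \<in> regular U2"
    using assms unfolding coboundaries_def by blast
  then have "scale_triple c t = (emb c * a - emb c * b, d (emb c * a), d (emb c * b))"
    by (simp add: d_emb_mult right_diff_distrib)
  then show ?thesis
    using r by (simp add: coboundaryI regular_mult regular_emb)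
qed

lemma scale_triple_minus_one: "scale_triple (- 1) t = - t"
  by (cases t) (simp add: emb_uminus emb_one scaleD_uminus scaleD_one)

lemma coboundaries_uminus: "t \<in> coboundaries \<Longrightarrow> - t \<in> coboundaries"
  using coboundaries_scale[of t "- 1"] by (simp add: scale_triple_minus_one)

lemma coboundaries_diff: "s \<in> coboundaries \<Longrightarrow> t \<in> coboundaries \<Longrightarrow> s - t \<in> coboundaries"
  using coboundaries_add[OF _ coboundaries_uminus] by fastforce

lemma scale_triple_diff: "scale_triple c (s - t) = scale_triple c s - scale_triple c t"
  by (cases s; cases t) (simp add: right_diff_distrib scaleD_right_diff)

lemma scale_triple_scale_triple: "scale_triple c (scale_triple c' t) = scale_triple (c * c') t"
  by (cases t) (simp add: emb_mult scaleD_scaleD mult.assoc)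

text \<open>The Cartier operator is computed on multiples of dx. Regularity at one point already
  gives that shape, so one point of each open set is used: the origin and infinity.\<close>

lemma cocycle_forms:
  assumes "(\<phi>, \<eta>1, \<eta>2) \<in> cocycles"
  shows "\<exists>f g. \<eta>1 = scaleD f (d x) \<and> \<eta>2 = scaleD g (d x)"
  using assms origin_in_U1 infty_in_U2 forms_at_dx unfolding cocycles_def regular_forms_eq by blast

end

subsection \<open>Semilinear maps on classes\<close>

context hermitian_curve
begin

lemma mem_dR_class:
  "t \<in> cocycles \<Longrightarrow> s \<in> dR_class t \<longleftrightarrow> s \<in> cocycles \<and> t - s \<in> coboundaries"
  by (auto simp: dR_class_def cohomologous_def)

lemma dR_class_self: "t \<in> cocycles \<Longrightarrow> t \<in> dR_class t"
  by (simp add: mem_dR_class coboundaries_zero)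

lemma dR_class_eqI:
  assumes "s \<in> cocycles" "t \<in> cocycles" "s - t \<in> coboundaries"
  shows "dR_class s = dR_class t"
proof -
  have "s - r \<in> coboundaries \<longleftrightarrow> t - r \<in> coboundaries" for r
    using coboundaries_add[of "s - t" "t - r"] coboundaries_diff[of "s - r" "s - t"] assms(3) by auto
  then show ?thesis
    by (simp add: set_eq_iff mem_dR_class assms)
qed

lemma dR_add_class:
  assumes "s \<in> cocycles" "t \<in> cocycles"
  shows "dR_add (dR_class s) (dR_class t) = dR_class (s + t)"
proof -
  have "dR_class (s' + t') = dR_class (s + t)" if "s' \<in> dR_class s" "t' \<in> dR_class t" for s' t'
  proof (rule dR_class_eqI[symmetric])
    have "s + t - (s' + t') = (s - s') + (t - t')"
      by (simp add: algebra_simps)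
    also have "\<dots> \<in> coboundaries"
      using that assms by (simp add: mem_dR_class coboundaries_add)
    finally show "s + t - (s' + t') \<in> coboundaries" .
  qed (use that assms in \<open>auto simp: mem_dR_class intro: cocycles_add\<close>)
  then show ?thesis
    unfolding dR_add_def using dR_class_self assms by blast
qed

lemma dR_scale_class:
  assumes "t \<in> cocycles"
  shows "dR_scale c (dR_class t) = dR_class (scale_triple c t)"
proof -
  have "dR_class (scale_triple c t') = dR_class (scale_triple c t)" if "t' \<in> dR_class t" for t'
    using that assms by (intro dR_class_eqI[symmetric])
      (auto simp: mem_dR_class coboundaries_scale simp flip: scale_triple_diff intro: cocycles_scale)
  then show ?thesis
    unfolding dR_scale_def using dR_class_self assms by blast
qed

lemma cocycles_diffD: "s - t \<in> coboundaries \<Longrightarrow> t \<in> cocycles \<Longrightarrow> s \<in> cocycles"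
  using cocycles_add[of "s - t" t] coboundaries_subset_cocycles by auto

lemma zero_in_cocycles: "0 \<in> cocycles"
  using coboundaries_zero coboundaries_subset_cocycles by blast

context
  fixes T :: "'F triple \<Rightarrow> 'F triple"
    and \<Phi> :: "'F triple set \<Rightarrow> 'F triple set"
    and \<sigma> :: "'k \<Rightarrow> 'k"
    and B :: "basis_symbol \<Rightarrow> 'F triple"
    and E :: "basis_symbol set"
  assumes \<Phi>: "\<And>t. t \<in> cocycles \<Longrightarrow> \<Phi> (dR_class t) = dR_class (T t)"
    and T_add: "\<And>s t. s \<in> cocycles \<Longrightarrow> t \<in> cocycles \<Longrightarrow> T (s + t) = T s + T t"
    and T_scale: "\<And>c t. t \<in> cocycles \<Longrightarrow> T (scale_triple c t) = scale_triple (\<sigma> c) (T t)"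
    and B: "\<And>e. e \<in> E \<Longrightarrow> B e \<in> cocycles"
begin

lemma T_zero: "T 0 = 0"
  using T_add[OF zero_in_cocycles zero_in_cocycles] by simp

text \<open>The hypotheses control \<open>T\<close> on cocycles rather than on classes, so the
  induction over the span carries a representative along with each class.\<close>

lemma semilinear_image_span_zero:
  assumes cob: "\<And>e. e \<in> E \<Longrightarrow> T (B e) \<in> coboundaries"
  shows "\<Phi> ` dR_span ((\<lambda>e. dR_class (B e)) ` E) = {dR_class 0}"
proof -
  have ex: "\<exists>t \<in> cocycles. A = dR_class t \<and> T t \<in> coboundaries"
    if "A \<in> dR_span ((\<lambda>e. dR_class (B e)) ` E)" for A
    using that
  proof (induction A)
    case zero
    then show ?case
      using zero_in_cocycles T_zero coboundaries_zero by metis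
  next
    case (step A A' c)
    then obtain e t where e: "A = dR_class (B e)" "e \<in> E"
      and t: "t \<in> cocycles" "A' = dR_class t" "T t \<in> coboundaries" by blast
    have s: "scale_triple c (B e) \<in> cocycles"
      using cocycles_scale B e by blast
    have "T (scale_triple c (B e) + t) \<in> coboundaries"
      using e s t B cob by (simp add: T_add T_scale coboundaries_add coboundaries_scale)
    then show ?case
      using e s t B
      by (intro bexI[of _ "scale_triple c (B e) + t"]) (simp_all add: dR_add_class dR_scale_class cocycles_add)
  qed
  then have "\<Phi> A = dR_class 0" if A: "A \<in> dR_span ((\<lambda>e. dR_class (B e)) ` E)" for A
  proof -
    obtain t where t: "t \<in> cocycles" "A = dR_class t" "T t \<in> coboundaries"
      using ex[OF A] by blast
    then have "dR_class (T t) = dR_class 0"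
      using coboundaries_subset_cocycles by (intro dR_class_eqI zero_in_cocycles) auto
    then show ?thesis
      using t \<Phi> by simp
  qed
  then show ?thesis
    using dR_span.zero by blast
qed

text \<open>\<open>into\<close> yields one inclusion, \<open>onto\<close> the other: its nonzero
  factor and the surjectivity of \<open>\<sigma>\<close> allow every coefficient of B e' to be
  attained. That \<open>T\<close> yields cocycles follows from the congruence with a multiple of B
  e'.\<close>

lemma semilinear_image_span:
  assumes B': "\<And>e. e \<in> E' \<Longrightarrow> B e \<in> cocycles"
    and \<sigma>: "\<And>c. \<exists>a. \<sigma> a = c"
    and into: "\<And>e. e \<in> E \<Longrightarrow> \<exists>e' \<in> E'. \<exists>c. T (B e) - scale_triple c (B e') \<in> coboundaries"
    and onto: "\<And>e'. e' \<in> E' \<Longrightarrow>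
      \<exists>e \<in> E. \<exists>c. c \<noteq> 0 \<and> T (B e) - scale_triple c (B e') \<in> coboundaries"
  shows "\<Phi> ` dR_span ((\<lambda>e. dR_class (B e)) ` E) = dR_span ((\<lambda>e. dR_class (B e)) ` E')"
    (is "\<Phi> ` ?S = ?S'")
proof -
  \<comment> \<open>The step shared by both inductions: modulo coboundaries, \<open>T\<close>
    replaces the summand a B e by (\<sigma> a * c) B e'.\<close>
  have combine: "T (scale_triple a (B e) + t) \<in> cocycles"
      "dR_class (T (scale_triple a (B e) + t)) = dR_add (dR_scale (\<sigma> a * c) (dR_class (B e'))) (dR_class (T t))"
    if "e \<in> E" "e' \<in> E'" "T (B e) - scale_triple c (B e') \<in> coboundaries"
      "t \<in> cocycles" "T t \<in> cocycles" for a e e' c t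
  proof -
    have cyc: "B e \<in> cocycles" "B e' \<in> cocycles" "scale_triple a (B e) \<in> cocycles"
      "T (B e) \<in> cocycles" "scale_triple (\<sigma> a * c) (B e') \<in> cocycles"
      "scale_triple (\<sigma> a) (T (B e)) \<in> cocycles"
      using that B B' cocycles_scale cocycles_diffD by blast+
    then show "T (scale_triple a (B e) + t) \<in> cocycles"
      using that by (simp add: T_add T_scale cocycles_add)
    have "scale_triple (\<sigma> a) (T (B e)) + T t - (scale_triple (\<sigma> a * c) (B e') + T t)
        = scale_triple (\<sigma> a) (T (B e) - scale_triple c (B e'))"
      by (simp add: scale_triple_diff scale_triple_scale_triple)
    also have "\<dots> \<in> coboundaries"
      using that coboundaries_scale by blast
    finally have "dR_class (scale_triple (\<sigma> a) (T (B e)) + T t)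
        = dR_class (scale_triple (\<sigma> a * c) (B e') + T t)"
      using cyc that by (intro dR_class_eqI cocycles_add)
    then show "dR_class (T (scale_triple a (B e) + t))
        = dR_add (dR_scale (\<sigma> a * c) (dR_class (B e'))) (dR_class (T t))"
      using cyc that by (simp add: T_add T_scale dR_add_class dR_scale_class)
  qed
  have fwd: "\<exists>t \<in> cocycles. A = dR_class t \<and> T t \<in> cocycles \<and> dR_class (T t) \<in> ?S'" if "A \<in> ?S" for A
    using that
  proof (induction A)
    case zero
    then show ?case
      using zero_in_cocycles T_zero dR_span.zero by (intro bexI[of _ 0]) auto
  next
    case (step A A' c)
    then obtain e t where e: "A = dR_class (B e)" "e \<in> E"
      and t: "t \<in> cocycles" "A' = dR_class t" "T t \<in> cocycles" "dR_class (T t) \<in> ?S'" by blast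
    obtain e' c' where e': "e' \<in> E'" "T (B e) - scale_triple c' (B e') \<in> coboundaries"
      using into e(2) by blast
    note * = combine[OF e(2) e' t(1,3), of c]
    have "dR_class (T (scale_triple c (B e) + t)) \<in> ?S'"
      unfolding *(2) using e' t by (auto intro: dR_span.step)
    moreover have "scale_triple c (B e) \<in> cocycles"
      using B e cocycles_scale by blast
    ultimately show ?case
      using * e t B by (intro bexI[of _ "scale_triple c (B e) + t"])
        (simp_all add: dR_add_class dR_scale_class cocycles_add)
  qed
  have bwd: "\<exists>t \<in> cocycles. dR_class t \<in> ?S \<and> T t \<in> cocycles \<and> dR_class (T t) = A" if "A \<in> ?S'" for A
    using that
  proof (induction A)
    case zero
    then show ?case
      using zero_in_cocycles T_zero dR_span.zero by (intro bexI[of _ 0]) auto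
  next
    case (step A A' c)
    then obtain e' t where e': "A = dR_class (B e')" "e' \<in> E'"
      and t: "t \<in> cocycles" "dR_class t \<in> ?S" "T t \<in> cocycles" "dR_class (T t) = A'" by blast
    obtain e c' where e: "e \<in> E" "c' \<noteq> 0" "T (B e) - scale_triple c' (B e') \<in> coboundaries"
      using onto e'(2) by blast
    \<comment> \<open>This choice gives B e' the prescribed coefficient c = \<sigma> a * c'.\<close>
    obtain a where a: "\<sigma> a = c / c'"
      using \<sigma> by blast
    note * = combine[OF e(1) e'(2) e(3) t(1,3), of a]
    have s: "scale_triple a (B e) \<in> cocycles"
      using B e cocycles_scale by blast
    have "dR_class (scale_triple a (B e) + t) = dR_add (dR_scale a (dR_class (B e))) (dR_class t)"
      using s e t B by (simp add: dR_add_class dR_scale_class)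
    also have "\<dots> \<in> ?S"
      using e t by (auto intro: dR_span.step)
    finally have "dR_class (scale_triple a (B e) + t) \<in> ?S" .
    then show ?case
      using * s e e' t a by (intro bexI[of _ "scale_triple a (B e) + t"]) (simp_all add: cocycles_add)
  qed
  show ?thesis
  proof (intro equalityI subsetI)
    fix A assume "A \<in> \<Phi> ` ?S"
    then obtain A' where "A = \<Phi> A'" "A' \<in> ?S" by blast
    with fwd[of A'] \<Phi> show "A \<in> ?S'" by auto
  next
    fix A assume "A \<in> ?S'"
    from bwd[OF this] \<Phi> show "A \<in> \<Phi> ` ?S" by (metis imageI)
  qed
qed

end

subsection \<open>Frobenius and Verschiebung on representatives\<close>

definition frob_triple :: "'F triple \<Rightarrow> 'F triple"
  where "frob_triple t = (fst t ^ p, 0, 0)"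

definition cartier_triple :: "'F triple \<Rightarrow> 'F triple"
  where "cartier_triple t = (0, cartier (fst (snd t)), cartier (snd (snd t)))"

text \<open>The inverse Frobenius of the constants, with respect to which the Cartier operator is
  semilinear.\<close>

definition k_root_of :: "'k \<Rightarrow> 'k"
  where "k_root_of c = (SOME a. a ^ p = c)"

lemma k_root_of_power: "k_root_of c ^ p = c"
  unfolding k_root_of_def using k_root by (rule someI_ex)

lemma k_root_of_surj: "\<exists>a. k_root_of a = c"
proof
  have "emb (k_root_of (c ^ p)) ^ p = emb c ^ p"
    unfolding emb_power[symmetric] k_root_of_power ..
  then have "emb (k_root_of (c ^ p)) = emb c"
    by (rule frob_inj)
  then have "emb (k_root_of (c ^ p) - c) = 0"
    by (simp add: additive_diff[of emb, OF emb_add])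
  then show "k_root_of (c ^ p) = c"
    by (simp add: emb_eq_zero_iff)
qed

lemma zero_pow_p: "(0 :: 'F) ^ p = 0"
  using p_ge_2 by simp

lemma frob_triple_add: "frob_triple (s + t) = frob_triple s + frob_triple t"
  by (simp add: frob_triple_def frob_add)

lemma frob_triple_scale: "frob_triple (scale_triple c t) = scale_triple (c ^ p) (frob_triple t)"
  by (cases t) (simp add: frob_triple_def power_mult_distrib emb_power scaleD_right_zero)

lemma frob_triple_cocycles:
  assumes "t \<in> cocycles"
  shows "frob_triple t \<in> cocycles"
proof -
  obtain \<phi> \<eta>1 \<eta>2 where t: "t = (\<phi>, \<eta>1, \<eta>2)" by (cases t)
  with assms have "\<phi> \<in> regular (U1 \<inter> U2)" by (simp add: cocycles_def)
  then show ?thesis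
    by (simp add: t frob_triple_def cocycles_def d_frob regular_power regular_forms_zero)
qed

lemma frob_triple_coboundaries:
  assumes "t \<in> coboundaries"
  shows "frob_triple t \<in> coboundaries"
proof -
  obtain a b where "t = (a - b, d a, d b)" "a \<in> regular U1" "b \<in> regular U2"
    using assms unfolding coboundaries_def by blast
  then show ?thesis
    using coboundaryI[of "a ^ p" "b ^ p"] by (simp add: frob_triple_def frob_diff d_frob regular_power)
qed

lemma F_dR_class:
  assumes t: "t \<in> cocycles"
  shows "F (dR_class t) = dR_class (frob_triple t)"
proof -
  have "dR_class (frob_triple s) = dR_class (frob_triple t)" if "s \<in> dR_class t" for s
  proof (rule dR_class_eqI[symmetric])
    have "frob_triple t - frob_triple s = frob_triple (t - s)"
      using additive_diff[of frob_triple, OF frob_triple_add] by simp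
    then show "frob_triple t - frob_triple s \<in> coboundaries"
      using that t by (simp add: mem_dR_class frob_triple_coboundaries)
  qed (use that t in \<open>auto simp: mem_dR_class frob_triple_cocycles\<close>)
  then have "(\<Union>s\<in>dR_class t. dR_class (frob_triple s)) = dR_class (frob_triple t)"
    using dR_class_self[OF t] by blast
  moreover have "F (dR_class t) = (\<Union>s\<in>dR_class t. dR_class (frob_triple s))"
    unfolding F_def frob_triple_def by (rule SUP_cong) (simp_all add: split_beta)
  ultimately show ?thesis by (simp only:)
qed

lemma cartier_add:
  "cartier (scaleD f (d x) + scaleD g (d x)) = cartier (scaleD f (d x)) + cartier (scaleD g (d x))"
  by (simp flip: scaleD_add add: cartier_scaleD cart_add)

lemma cartier_emb: "cartier (scaleD (emb c) (scaleD f (d x))) = scaleD (emb (k_root_of c)) (cartier (scaleD f (d x)))"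
proof -
  have "emb c = emb (k_root_of c) ^ p"
    unfolding emb_power[symmetric] k_root_of_power ..
  then show ?thesis
    by (simp add: scaleD_scaleD cartier_scaleD cart_frob_mult)
qed

lemma cartier_d: "cartier (d f) = 0"
  by (simp add: d_eq[of f] cartier_scaleD cart_D0 scaleD_zero)

lemma cartier_triple_add:
  assumes "s \<in> cocycles" "t \<in> cocycles"
  shows "cartier_triple (s + t) = cartier_triple s + cartier_triple t"
proof -
  obtain \<phi> \<eta>1 \<eta>2 \<phi>' \<eta>1' \<eta>2' where st: "s = (\<phi>, \<eta>1, \<eta>2)" "t = (\<phi>', \<eta>1', \<eta>2')"
    by (cases s, cases t)
  obtain f g where "\<eta>1 = scaleD f (d x)" "\<eta>2 = scaleD g (d x)"
    using cocycle_forms assms st by blast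
  moreover obtain f' g' where "\<eta>1' = scaleD f' (d x)" "\<eta>2' = scaleD g' (d x)"
    using cocycle_forms assms st by blast
  ultimately show ?thesis
    by (simp add: st cartier_triple_def cartier_add)
qed

lemma cartier_triple_scale:
  assumes "t \<in> cocycles"
  shows "cartier_triple (scale_triple c t) = scale_triple (k_root_of c) (cartier_triple t)"
proof -
  obtain \<phi> \<eta>1 \<eta>2 where t: "t = (\<phi>, \<eta>1, \<eta>2)" by (cases t)
  obtain f g where "\<eta>1 = scaleD f (d x)" "\<eta>2 = scaleD g (d x)"
    using cocycle_forms assms t by blast
  then show ?thesis
    by (simp add: t cartier_triple_def cartier_emb)
qed

text \<open>By \<open>cart_D0\<close> exact differentials are killed on the nose, so all
  representatives of a class have the same image triple.\<close>

lemma cartier_triple_coboundaries: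
  assumes "t \<in> coboundaries"
  shows "cartier_triple t = 0"
  using assms by (auto simp: coboundaries_def cartier_triple_def cartier_d zero_prod_def)

lemma V_dR_class:
  assumes t: "t \<in> cocycles"
  shows "V (dR_class t) = dR_class (cartier_triple t)"
proof -
  have "cartier_triple s = cartier_triple t" if "s \<in> dR_class t" for s
  proof -
    have s: "s \<in> cocycles" "t - s \<in> coboundaries"
      using that t by (simp_all add: mem_dR_class)
    then have "cartier_triple ((t - s) + s) = cartier_triple (t - s) + cartier_triple s"
      using coboundaries_subset_cocycles by (intro cartier_triple_add) auto
    then show ?thesis
      using s by (simp add: cartier_triple_coboundaries)
  qed
  then have "(\<Union>s\<in>dR_class t. dR_class (cartier_triple s))
      = (\<Union>s\<in>dR_class t. dR_class (cartier_triple t))"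
    by (intro SUP_cong) simp_all
  also have "\<dots> = dR_class (cartier_triple t)"
    using dR_class_self[OF t] by (intro SUP_const) blast
  finally have "(\<Union>s\<in>dR_class t. dR_class (cartier_triple s)) = dR_class (cartier_triple t)" .
  moreover have "V (dR_class t) = (\<Union>s\<in>dR_class t. dR_class (cartier_triple s))"
    unfolding V_def cartier_triple_def by (rule SUP_cong) (simp_all add: split_beta)
  ultimately show ?thesis by (simp only:)
qed

end

subsection \<open>The action on the basis\<close>

text \<open>From b <= m follows (m+1) b <= m (b+1). With m = q it makes y^b / x^a regular at
  infinity as soon as b < a and b <= q.\<close>

lemma pole_order_bound: "b < a \<Longrightarrow> b \<le> m \<Longrightarrow> (m + 1) * b \<le> m * (a :: nat)"
proof -
  assume "b < a" "b \<le> m"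
  then have "m * (b + 1) \<le> m * a" by (intro mult_le_mono) auto
  with \<open>b \<le> m\<close> show ?thesis by (simp add: algebra_simps)
qed

text \<open>The binomial coefficient divides m!, which a larger prime does not divide. It keeps the
  surviving coefficient of each expansion nonzero.\<close>

lemma prime_not_dvd_choose:
  assumes "prime (l :: nat)" "m < l" "k \<le> m"
  shows "\<not> l dvd (m choose k)"
proof
  assume "l dvd (m choose k)"
  then have "l dvd fact k * fact (m - k) * (m choose k)" by simp
  then show False
    using assms by (simp add: binomial_fact_lemma prime_dvd_fact_iff)
qed

context hermitian_curve
begin

abbreviation r :: nat
  where "r \<equiv> p ^ (n - 1)"

lemma q_eq: "q = p * r"
  using n_ge_2 by (simp flip: power_Suc)

fun basis_triple :: "basis_symbol \<Rightarrow> 'F triple"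
  where
    "basis_triple (Om i j) = (0, scaleD (x ^ i * y ^ j) (d x), scaleD (x ^ i * y ^ j) (d x))"
  | "basis_triple (Ft i j) = (y ^ (q - 1) / (x ^ (i + 1) * y ^ j),
      scaleD (- of_nat (j + 1) * y ^ (q - j - 2) * x ^ (q - i - 1)) (d x),
      scaleD (of_nat (i + 1) * y ^ (q - j - 1) / x ^ (i + 2)) (d x))"

lemma basis_elem_eq: "basis_elem e = dR_class (basis_triple e)"
  by (cases e) simp_all

lemma D0_quotient:
  "D0 (y ^ b / x ^ a) = of_nat b * y ^ (b - 1) * x ^ q / x ^ a - of_nat a * y ^ b / x ^ (a + 1)"
proof -
  have "D0 (y ^ b / x ^ a * x ^ a) = D0 (y ^ b)"
    using x_nonzero by simp
  then have "y ^ b / x ^ a * (of_nat a * x ^ (a - 1)) + x ^ a * D0 (y ^ b / x ^ a)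
      = of_nat b * y ^ (b - 1) * x ^ q"
    by (simp only: D0_mult derivation_power[of D0, OF D0_mult] D0_x D0_y) simp
  moreover have "y ^ b / x ^ a * (of_nat a * x ^ (a - 1)) = x ^ a * (of_nat a * y ^ b / x ^ (a + 1))"
    using x_nonzero by (cases a) (simp_all add: field_simps)
  ultimately have "x ^ a * D0 (y ^ b / x ^ a)
      = of_nat b * y ^ (b - 1) * x ^ q - x ^ a * (of_nat a * y ^ b / x ^ (a + 1))"
    by (simp only: eq_diff_eq add.commute)
  then have "D0 (y ^ b / x ^ a)
      = (of_nat b * y ^ (b - 1) * x ^ q - x ^ a * (of_nat a * y ^ b / x ^ (a + 1))) / x ^ a"
    using x_nonzero by (simp add: eq_divide_eq mult.commute)
  then show ?thesis
    using x_nonzero by (simp only: diff_divide_distrib) simp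
qed

lemma of_nat_cong_p:
  assumes "m + m' = p * k"
  shows "of_nat m = - (of_nat m' :: 'F)"
proof -
  have "of_nat (m + m') = (0 :: 'F)"
    by (simp only: assms of_nat_mult of_nat_p) simp
  then show ?thesis by (simp add: eq_neg_iff_add_eq_0)
qed

lemma Ft_fun_eq:
  assumes "j + 1 \<le> q"
  shows "y ^ (q - 1) / (x ^ (i + 1) * y ^ j) = y ^ (q - j - 1) / x ^ (i + 1)"
proof -
  have "q - 1 = (q - j - 1) + j" using assms by simp
  then have "y ^ (q - 1) = y ^ (q - j - 1) * y ^ j" by (metis power_add)
  then show ?thesis using y_nonzero by simp
qed

text \<open>The function is y^(q-j-1) / x^(i+1), and q - j - 1 = -(j+1) in characteristic p; the two
  terms of \<open>D0_quotient\<close> are then the two forms of the triple.\<close>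

lemma d_Ft_fun:
  assumes "i + j \<le> q - 2"
  shows "d (y ^ (q - 1) / (x ^ (i + 1) * y ^ j))
    = scaleD (- of_nat (j + 1) * y ^ (q - j - 2) * x ^ (q - i - 1)) (d x)
    - scaleD (of_nat (i + 1) * y ^ (q - j - 1) / x ^ (i + 2)) (d x)"
proof -
  have ij: "j + 1 \<le> q" "i + 1 \<le> q" using assms q_ge_4 by auto
  have xq: "x ^ q = x ^ (q - i - 1) * x ^ (i + 1)"
  proof -
    have "q = (q - i - 1) + (i + 1)" using ij by simp
    then show ?thesis by (metis power_add)
  qed
  have "of_nat (q - j - 1) = - (of_nat (j + 1) :: 'F)"
    by (rule of_nat_cong_p[of _ _ r]) (use ij q_eq in simp)
  then have "D0 (y ^ (q - j - 1) / x ^ (i + 1))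
      = - of_nat (j + 1) * y ^ (q - j - 2) * x ^ (q - i - 1)
        - of_nat (i + 1) * y ^ (q - j - 1) / x ^ (i + 2)"
    unfolding D0_quotient xq using x_nonzero by (simp del: of_nat_add of_nat_Suc)
  then show ?thesis
    unfolding Ft_fun_eq[OF ij(1)] by (simp only: d_eq[of "y ^ _ / _"] scaleD_diff)
qed

lemma basis_triple_cocycle:
  assumes "e \<in> basis_symbols"
  shows "basis_triple e \<in> cocycles"
proof -
  obtain i j where ij: "i + j \<le> q - 2" and e: "e = Om i j \<or> e = Ft i j"
    using assms by (auto simp: basis_symbols_def \<Delta>_def)
  have "basis_triple (Om i j) \<in> cocycles"
    using ij by (simp add: cocycles_def d_zero regular_zero regular_forms_U1_monomial
        regular_forms_U2_holomorphic)
  moreover have "basis_triple (Ft i j) \<in> cocycles"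
  proof -
    have j: "j + 1 \<le> q" using ij q_ge_4 by auto
    have 1: "y ^ (q - 1) / (x ^ (i + 1) * y ^ j) \<in> regular (U1 \<inter> U2)"
      unfolding Ft_fun_eq[OF j] by (rule regular_U12_monomial)
    have "scaleD (emb (- of_nat (j + 1))) (scaleD (x ^ (q - i - 1) * y ^ (q - j - 2)) (d x))
        \<in> regular_forms U1"
      by (intro regular_forms_scaleD regular_forms_U1_monomial regular_emb)
    then have 2: "scaleD (- of_nat (j + 1) * y ^ (q - j - 2) * x ^ (q - i - 1)) (d x) \<in> regular_forms U1"
      by (simp only: scaleD_scaleD emb_uminus emb_of_nat mult.commute mult.left_commute)
    \<comment> \<open>Order at infinity of the second form: the pole of y^(q-j-1) exceeds the zero
      of dx by at most q + 1, which 1/x^(i+2) compensates since q + 1 <= 2q.\<close>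
    have "q - j - 1 \<le> (q - 2) + 1" using q_ge_4 by simp
    then have "(q + 1) * (q - j - 1) \<le> (q + 1) * (q - 2) + (q + 1)"
      by (metis mult.right_neutral distrib_left mult_le_mono2)
    moreover have "q + 1 \<le> q * (i + 2)" using q_ge_4 by simp
    ultimately have "(q + 1) * (q - j - 1) \<le> q * (i + 2) + (q + 1) * (q - 2)" by linarith
    then have "scaleD (emb (of_nat (i + 1))) (scaleD (y ^ (q - j - 1) / x ^ (i + 2)) (d x))
        \<in> regular_forms U2"
      by (intro regular_forms_scaleD regular_forms_U2_monomial regular_emb)
    then have 3: "scaleD (of_nat (i + 1) * y ^ (q - j - 1) / x ^ (i + 2)) (d x) \<in> regular_forms U2"
      by (simp only: scaleD_scaleD emb_of_nat times_divide_eq_right)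
    show ?thesis
      using 1 2 3 d_Ft_fun[OF ij] unfolding cocycles_def basis_triple.simps by blast
  qed
  ultimately show ?thesis using e by blast
qed

text \<open>As x^q and y^q are p-th powers, the expansion of y^t leaves only factors x^(s+k) with k
  <= t outside the p-th powers. The surviving index k = p-1-s is in range iff s + t + 1 >= p; the
  p-th roots of x^(q k) and y^(q (t-k)) are the blocks with exponents r (p-1-s) and r
  (s+t+1-p).\<close>

lemma cart_monomial:
  assumes "s < p" "t < p"
  shows "\<exists>c. c \<noteq> 0 \<and> cart (x ^ (s + p * u) * y ^ (t + p * v)) =
    (if s + t + 1 < p then 0 else emb c * (x ^ (u + r * (p - 1 - s)) * y ^ (v + r * (s + t + 1 - p))))"
proof -
  \<comment> \<open>p-th roots of the signed binomial coefficients, so that these can move inside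
    the p-th powers.\<close>
  define C where "C k = k_root_of (of_nat (t choose k) * (- 1) ^ (t - k))" for k
  have C: "emb (C k) ^ p = of_nat (t choose k) * (- 1) ^ (t - k)" for k
    unfolding C_def emb_power[symmetric] k_root_of_power
    by (simp add: emb_mult emb_of_nat emb_power emb_uminus emb_one)
  have "y ^ t = (x ^ (q + 1) + - (y ^ q)) ^ t"
    unfolding curve_eq[symmetric] by simp
  also have "\<dots> = (\<Sum>k\<le>t. of_nat (t choose k) * (x ^ (q + 1)) ^ k * (- (y ^ q)) ^ (t - k))"
    by (rule binomial_ring)
  also have "\<dots> = (\<Sum>k\<le>t. (emb (C k) * x ^ (r * k) * y ^ (r * (t - k))) ^ p * x ^ k)"
  proof (rule sum.cong)
    fix k
    have "(- (y ^ q)) ^ (t - k) = (- 1) ^ (t - k) * (y ^ (r * (t - k))) ^ p"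
      by (subst power_minus) (simp add: q_eq mult_ac flip: power_mult)
    moreover have "(x ^ (q + 1)) ^ k = (x ^ (r * k)) ^ p * x ^ k"
      by (simp add: q_eq algebra_simps power_add flip: power_mult)
    ultimately show "of_nat (t choose k) * (x ^ (q + 1)) ^ k * (- (y ^ q)) ^ (t - k)
        = (emb (C k) * x ^ (r * k) * y ^ (r * (t - k))) ^ p * x ^ k"
      by (simp only: power_mult_distrib C mult_ac)
  qed simp
  finally have yt: "y ^ t = (\<Sum>k\<le>t. (emb (C k) * x ^ (r * k) * y ^ (r * (t - k))) ^ p * x ^ k)" .
  have "x ^ (s + p * u) * y ^ (t + p * v)
      = (x ^ u * y ^ v) ^ p * (\<Sum>k\<le>t. (emb (C k) * x ^ (r * k) * y ^ (r * (t - k))) ^ p * x ^ (s + k))"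
  proof -
    have pow: "z ^ (l + p * m) = (z ^ m) ^ p * z ^ l" for z :: 'F and l m
      by (simp add: power_add mult.commute flip: power_mult)
    show ?thesis
      unfolding pow yt power_add[of x s]
      by (simp only: sum_distrib_left sum_distrib_right power_mult_distrib mult_ac)
  qed
  then have "cart (x ^ (s + p * u) * y ^ (t + p * v))
      = x ^ u * y ^ v * (\<Sum>k\<le>t. emb (C k) * x ^ (r * k) * y ^ (r * (t - k)) * cart (x ^ (s + k)))"
    by (simp only: cart_frob_mult additive_sum[of cart, OF cart_add])
  also have "(\<Sum>k\<le>t. emb (C k) * x ^ (r * k) * y ^ (r * (t - k)) * cart (x ^ (s + k)))
      = (\<Sum>k\<le>t. if k = p - 1 - s then emb (C k) * x ^ (r * k) * y ^ (r * (t - k)) else 0)"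
    using assms by (intro sum.cong) (auto simp: cart_x_power)
  also have "\<dots> = (if p - 1 - s \<le> t then
      emb (C (p - 1 - s)) * x ^ (r * (p - 1 - s)) * y ^ (r * (t - (p - 1 - s))) else 0)"
    by simp
  finally have cart: "cart (x ^ (s + p * u) * y ^ (t + p * v)) = x ^ u * y ^ v * (if p - 1 - s \<le> t then
      emb (C (p - 1 - s)) * x ^ (r * (p - 1 - s)) * y ^ (r * (t - (p - 1 - s))) else 0)" .
  show ?thesis
  proof (cases "s + t + 1 < p")
    case True
    then show ?thesis using cart by (intro exI[of _ 1]) simp
  next
    case False
    have "\<not> p dvd (t choose (p - 1 - s))"
      using prime_p assms False by (intro prime_not_dvd_choose) auto
    then have "emb (C (p - 1 - s)) ^ p \<noteq> 0"
      by (simp add: C of_nat_F_eq_zero_iff)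
    then have "C (p - 1 - s) \<noteq> 0"
      using emb_zero zero_pow_p by auto
    moreover have "t - (p - 1 - s) = s + t + 1 - p" "p - 1 - s \<le> t"
      using False assms by auto
    ultimately show ?thesis
      using cart False by (intro exI[of _ "C (p - 1 - s)"]) (simp add: power_add mult_ac)
  qed
qed

end

text \<open>In the base-\<open>p\<close> digits of \<open>i = s + p u\<close> and \<open>j = t + p v\<close> the Cartier operator moves the lowest
  digits to the top; the two definitions describe when it maps the basis element with index \<open>(i, j)\<close>
  to a nonzero multiple of \<open>\<omega>_{I,J}\<close>: \<open>omega_shift\<close> for \<open>\<omega>_{i,j}\<close>, \<open>f_shift\<close> for
  \<open>f_{i,j}\<close>. Frobenius runs through the same correspondences backwards.\<close>

definition omega_shift :: "nat \<Rightarrow> nat \<Rightarrow> nat \<Rightarrow> nat \<Rightarrow> nat \<Rightarrow> nat \<Rightarrow> bool"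
  where "omega_shift p r i j I J \<longleftrightarrow> (\<exists>s t u v. s < p \<and> t < p \<and> p \<le> s + t + 1 \<and> u < r \<and> v < r \<and>
    u + v + 2 \<le> r \<and> i = s + p * u \<and> j = t + p * v \<and>
    I = u + r * (p - 1 - s) \<and> J = v + r * (s + t + 1 - p))"

definition f_shift :: "nat \<Rightarrow> nat \<Rightarrow> nat \<Rightarrow> nat \<Rightarrow> nat \<Rightarrow> nat \<Rightarrow> bool"
  where "f_shift p r i j I J \<longleftrightarrow> (\<exists>s t u v. s + t + 2 \<le> p \<and> u < r \<and> v < r \<and>
    u + v + 1 \<le> r \<and> i = s + p * u \<and> j = t + p * v \<and>
    I = (r - 1 - u) + r * s \<and> J = (r - 1 - v) + r * (p - 2 - s - t))"

context hermitian_curve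
begin

lemma r_pos: "r > 0"
  using p_ge_2 by simp

lemma cartier_triple_Om_zero:
  assumes "i mod p + j mod p + 1 < p"
  shows "cartier_triple (basis_triple (Om i j)) = 0"
proof -
  have "i mod p < p" "j mod p < p" using p_ge_2 by auto
  from cart_monomial[OF this, of "i div p" "j div p"] assms have "cart (x ^ i * y ^ j) = 0"
    by auto
  then show ?thesis
    by (simp add: cartier_triple_def cartier_scaleD scaleD_zero zero_prod_def)
qed

lemma cartier_triple_Om:
  assumes "omega_shift p r i j I J"
  shows "\<exists>c. c \<noteq> 0 \<and> cartier_triple (basis_triple (Om i j)) = scale_triple c (basis_triple (Om I J))"
proof -
  obtain s t u v where *: "s < p" "t < p" "p \<le> s + t + 1" "i = s + p * u" "j = t + p * v"
    "I = u + r * (p - 1 - s)" "J = v + r * (s + t + 1 - p)"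
    using assms unfolding omega_shift_def by blast
  obtain c where "c \<noteq> 0" "cart (x ^ i * y ^ j) = emb c * (x ^ I * y ^ J)"
    using cart_monomial[OF *(1,2), of u v] *(3-) by auto
  then show ?thesis
    by (intro exI[of _ c]) (simp add: cartier_triple_def cartier_scaleD scaleD_scaleD)
qed

text \<open>The two forms differ by the exact form d f_{i,j}, so they have the same Cartier image
  and the monomial form on \<open>U1\<close> suffices. The witness is a p-th root of -(j+1), whence
  the criterion for c = 0.\<close>

lemma cartier_triple_Ft:
  assumes "i + j \<le> q - 2"
  shows "\<exists>c. (c = 0 \<longleftrightarrow> p dvd j + 1) \<and> cartier_triple (basis_triple (Ft i j)) =
    (0, scaleD (emb c * cart (x ^ (q - i - 1) * y ^ (q - j - 2))) (d x),
        scaleD (emb c * cart (x ^ (q - i - 1) * y ^ (q - j - 2))) (d x))"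
proof -
  define c where "c = k_root_of (- of_nat (j + 1))"
  have c: "emb c ^ p = - of_nat (j + 1)"
    unfolding c_def emb_power[symmetric] k_root_of_power by (simp add: emb_uminus emb_of_nat del: of_nat_Suc of_nat_add)
  let ?\<eta>1 = "- of_nat (j + 1) * y ^ (q - j - 2) * x ^ (q - i - 1)"
  let ?\<eta>2 = "of_nat (i + 1) * y ^ (q - j - 1) / x ^ (i + 2)"
  have "cartier (scaleD (?\<eta>1 - ?\<eta>2) (d x)) = 0"
    using d_Ft_fun[OF assms] cartier_d by (metis scaleD_diff)
  then have "cart (?\<eta>1 - ?\<eta>2) = 0"
    by (metis cartier_scaleD scaleD_zero scaleD_dx_inj)
  then have 2: "cart ?\<eta>2 = cart ?\<eta>1"
    by (simp only: additive_diff[of cart, OF cart_add]) simp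
  have "?\<eta>1 = emb c ^ p * (x ^ (q - i - 1) * y ^ (q - j - 2))"
    unfolding c by (simp only: mult_ac)
  then have 1: "cart ?\<eta>1 = emb c * cart (x ^ (q - i - 1) * y ^ (q - j - 2))"
    by (simp only: cart_frob_mult)
  have "c = 0 \<longleftrightarrow> emb c ^ p = 0"
    using p_ge_2 by (simp add: emb_eq_zero_iff)
  also have "\<dots> \<longleftrightarrow> p dvd j + 1"
    unfolding c using of_nat_F_eq_zero_iff[of "j + 1"] by (simp only: neg_equal_0_iff_equal)
  finally show ?thesis
    by (intro exI[of _ c] conjI)
      (simp_all only: basis_triple.simps cartier_triple_def fst_conv snd_conv cartier_scaleD 1 2)
qed

text \<open>q - 1 = (p-1) + p (r-1), so subtracting from it complements both blocks without a
  borrow.\<close>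

lemma complement_digits:
  assumes "s < p" "u < r"
  shows "q - (s + p * u) - 1 = (p - 1 - s) + p * (r - 1 - u)"
proof -
  obtain a b where "p = s + 1 + a" "r = u + 1 + b"
    using assms by (metis Suc_eq_plus1 less_iff_Suc_add add_Suc_right add.assoc add.commute)
  moreover from this have "q = (s + p * u) + 1 + (a + p * b)"
    unfolding q_eq by (simp only: distrib_left) simp
  ultimately show ?thesis by simp
qed

text \<open>The bound t <= p - 2 lets the lowest digit absorb the second subtracted unit.\<close>

lemma complement_digits':
  assumes "t + 2 \<le> p" "v < r"
  shows "q - (t + p * v) - 2 = (p - 2 - t) + p * (r - 1 - v)"
proof -
  have "q - (t + p * v) - 2 = (q - (t + p * v) - 1) - 1" by simp
  also have "\<dots> = (p - 1 - t - 1) + p * (r - 1 - v)"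
    using complement_digits[of t v] assms by simp
  also have "p - 1 - t - 1 = p - 2 - t" by simp
  finally show ?thesis .
qed

lemma cartier_triple_Ft_zero:
  assumes "i + j \<le> q - 2" "p \<le> i mod p + j mod p + 1"
  shows "cartier_triple (basis_triple (Ft i j)) = 0"
proof -
  obtain c where c: "c = 0 \<longleftrightarrow> p dvd j + 1" and eq: "cartier_triple (basis_triple (Ft i j)) =
    (0, scaleD (emb c * cart (x ^ (q - i - 1) * y ^ (q - j - 2))) (d x),
        scaleD (emb c * cart (x ^ (q - i - 1) * y ^ (q - j - 2))) (d x))"
    using cartier_triple_Ft[OF assms(1)] by blast
  have zero: "emb c * cart (x ^ (q - i - 1) * y ^ (q - j - 2)) = 0"
  \<comment> \<open>If p divides j + 1 the scalar is 0. Otherwise the lowest digit t of j is at most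
    p - 2, the complemented digits are p-1-s and p-2-t, and their sum plus 1 is below p iff s + t +
    1 >= p.\<close>
  proof (cases "p dvd j + 1")
    case True
    then show ?thesis using c emb_zero by simp
  next
    case False
    have "i < p * r" "j < p * r"
      using assms(1) q_ge_4 unfolding q_eq by auto
    then have uv: "i div p < r" "j div p < r"
      by (simp_all add: less_mult_imp_div_less mult.commute)
    have st: "i mod p < p" "j mod p < p" using p_ge_2 by auto
    have "j mod p \<noteq> p - 1"
    proof
      assume "j mod p = p - 1"
      then have "j + 1 = p * (j div p + 1)"
        using p_ge_2 by (metis Suc_eq_plus1 Suc_pred' add.assoc distrib_left div_mult_mod_eq
            mult.commute mult.right_neutral pos2 order_less_le_trans)
      with False show False by (metis dvd_triv_left)
    qed
    then have "q - j - 2 = (p - 2 - j mod p) + p * (r - 1 - j div p)"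
      using complement_digits'[OF _ uv(2), of "j mod p"] st by simp
    moreover have "q - i - 1 = (p - 1 - i mod p) + p * (r - 1 - i div p)"
      using complement_digits[OF st(1) uv(1)] by simp
    moreover have "p - 1 - i mod p < p" "p - 2 - j mod p < p"
      "(p - 1 - i mod p) + (p - 2 - j mod p) + 1 < p"
      using st assms(2) p_ge_2 \<open>j mod p \<noteq> p - 1\<close> by linarith+
    ultimately have "cart (x ^ (q - i - 1) * y ^ (q - j - 2)) = 0"
      using cart_monomial[of "p - 1 - i mod p" "p - 2 - j mod p" "r - 1 - i div p" "r - 1 - j div p"]
      by auto
    then show ?thesis by simp
  qed
  show ?thesis
    unfolding eq zero by (simp add: scaleD_zero zero_prod_def)
qed

text \<open>The formulas of \<open>f_shift\<close> are those of \<open>cart_monomial\<close> for the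
  complemented data p-1-s, p-2-t, r-1-u, r-1-v. Since t + 1 < p, the scalar coming from j + 1 is
  nonzero.\<close>

lemma cartier_triple_Ft_shift:
  assumes "i + j \<le> q - 2" "f_shift p r i j I J"
  shows "\<exists>c. c \<noteq> 0 \<and> cartier_triple (basis_triple (Ft i j)) = scale_triple c (basis_triple (Om I J))"
proof -
  obtain s t u v where *: "s + t + 2 \<le> p" "u < r" "v < r" "i = s + p * u" "j = t + p * v"
    "I = (r - 1 - u) + r * s" "J = (r - 1 - v) + r * (p - 2 - s - t)"
    using assms unfolding f_shift_def by blast
  obtain c where c: "c = 0 \<longleftrightarrow> p dvd j + 1" and eq: "cartier_triple (basis_triple (Ft i j)) =
    (0, scaleD (emb c * cart (x ^ (q - i - 1) * y ^ (q - j - 2))) (d x),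
        scaleD (emb c * cart (x ^ (q - i - 1) * y ^ (q - j - 2))) (d x))"
    using cartier_triple_Ft[OF assms(1)] by blast
  have "\<not> p dvd t + 1"
    using * by (simp add: nat_dvd_not_less)
  moreover have "p dvd j + 1 \<longleftrightarrow> p dvd t + 1"
    using dvd_add_left_iff[of p "p * v" "t + 1"] by (simp add: * algebra_simps)
  ultimately have "c \<noteq> 0" using c by simp
  have "q - i - 1 = (p - 1 - s) + p * (r - 1 - u)"
    unfolding *(4) using * by (intro complement_digits) auto
  moreover have "q - j - 2 = (p - 2 - t) + p * (r - 1 - v)"
    unfolding *(5) using * by (intro complement_digits') auto
  moreover have "p - 1 - s < p" "p - 2 - t < p" "\<not> (p - 1 - s) + (p - 2 - t) + 1 < p"
    "p - 1 - (p - 1 - s) = s" "(p - 1 - s) + (p - 2 - t) + 1 - p = p - 2 - s - t"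
    using *(1) by simp_all
  ultimately obtain c' where c': "c' \<noteq> 0"
    "cart (x ^ (q - i - 1) * y ^ (q - j - 2)) = emb c' * (x ^ I * y ^ J)"
    using cart_monomial[of "p - 1 - s" "p - 2 - t" "r - 1 - u" "r - 1 - v"] *(6,7) by auto
  show ?thesis
    unfolding eq c'(2) using \<open>c \<noteq> 0\<close> c'(1)
    by (intro exI[of _ "c * c'"]) (simp add: scaleD_scaleD emb_mult mult.assoc)
qed

section \<open>Frobenius on the representatives\<close>

lemma frob_triple_Om: "frob_triple (basis_triple (Om i j)) = 0"
  using zero_pow_p by (simp add: frob_triple_def zero_prod_def)

text \<open>Expanding \<open>y^(q N) = (x^(q+1) - y)^N\<close> splits the \<open>p\<close>-th power of \<open>f_{I,J}\<close> into terms regular on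
  \<open>U1\<close>, one middle term, and terms regular on \<open>U2\<close>. The derivatives of the terms telescope.\<close>

lemma frob_expansion:
  assumes p: "p = j1 + 1 + N" and le: "i1 \<le> N" and w: "r = v + 1 + w" and z: "r = u + 1 + z"
    and I: "I = u + r * i1" and J: "J = v + r * j1"
  shows "\<exists>A B c. A \<in> regular U1 \<and> B \<in> regular U2 \<and> c \<noteq> 0 \<and>
    (y ^ (q - 1) / (x ^ (I + 1) * y ^ J)) ^ p
      = A + emb c * (y ^ (N - i1 + p * w) / x ^ (p * (u + 1) - i1)) + B \<and>
    D0 A = emb (- of_nat (N - i1) * c) * (x ^ (i1 + p * z) * y ^ (N - i1 - 1 + p * w))"
proof -
  define C :: "nat \<Rightarrow> 'k" where "C k = of_nat (N choose k) * (- 1) ^ (N - k)" for k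
  define L where "L = q * i1 + p * (u + 1)"
  define T where "T k = emb (C k) * (x ^ ((q + 1) * k) * y ^ (N - k + p * w) / x ^ L)" for k
  \<comment> \<open>The part of the derivative of T (i1+1+l) that comes from the power of
    \<open>x\<close>; the part from the power of \<open>y\<close> is - G (l+1).\<close>
  define G where "G l = emb (of_nat (i1 + 1 + l) * C (i1 + 1 + l)) *
    (x ^ ((q + 1) * l + i1 + p * z) * y ^ (N - (i1 + 1 + l) + p * w))" for l
  have qz: "q = p * (u + 1) + p * z" unfolding q_eq z by (simp only: distrib_left)
  have qw: "q = p * v + p + p * w" unfolding q_eq w by (simp add: distrib_left)
  \<comment> \<open>The absorption identity for binomial coefficients with alternating sign; this is
    what makes the derivatives telescope.\<close>
  have C_rec: "of_nat (k + 1) * C (k + 1) = - of_nat (N - k) * C k" if "k \<le> N" for k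
  proof (cases "k = N")
    case True
    then show ?thesis by (simp add: C_def binomial_eq_0)
  next
    case False
    then have "N - k = Suc (N - (k + 1))" using that by simp
    moreover have "(k + 1) * (N choose (k + 1)) = (N - k) * (N choose k)"
      using binomial_absorption[of k N] binomial_absorb_comp[of N k] by simp
    then have "of_nat (k + 1) * of_nat (N choose (k + 1)) = (of_nat (N - k) * of_nat (N choose k) :: 'k)"
      by (metis of_nat_mult)
    ultimately show ?thesis
      unfolding C_def by (simp only: power_Suc mult.assoc[symmetric]) (simp del: of_nat_Suc of_nat_add)
  qed
  have "p * (q - 1 - J) = q * N + p * w"
  proof -
    have "q = (j1 + 1 + N) * r"
      unfolding p[symmetric] by (rule q_eq)
    also have "\<dots> = r * j1 + r + r * N"
      by (simp only: distrib_right distrib_left mult.commute mult_1_right)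
    also have "\<dots> = 1 + J + (r * N + w)"
      unfolding J using w by linarith
    finally have "q = 1 + J + (r * N + w)" .
    then have "q - 1 - J = r * N + w" by simp
    then show ?thesis by (simp add: q_eq distrib_left)
  qed
  have "J + 1 \<le> q"
  proof -
    have "J + 1 \<le> r * (j1 + 1)" using w by (simp add: J)
    also have "\<dots> \<le> r * p" using p by (intro mult_le_mono) auto
    finally show ?thesis by (simp add: q_eq mult.commute)
  qed
  then have "(y ^ (q - 1) / (x ^ (I + 1) * y ^ J)) ^ p = (y ^ (q - 1 - J) / x ^ (I + 1)) ^ p"
    by (simp only: Ft_fun_eq diff_commute[of q J 1])
  also have "\<dots> = y ^ (p * (q - 1 - J)) / x ^ L"
  proof -
    have "L = (I + 1) * p"
      by (simp add: L_def I q_eq algebra_simps)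
    then show ?thesis
      by (simp only: power_divide power_mult[symmetric] mult.commute[of p])
  qed
  also have "\<dots> = (y ^ q) ^ N * y ^ (p * w) / x ^ L"
    unfolding \<open>p * (q - 1 - J) = q * N + p * w\<close> by (simp only: power_add power_mult)
  also have "y ^ q = x ^ (q + 1) + - y"
    unfolding curve_eq[symmetric] by simp
  also have "(x ^ (q + 1) + - y) ^ N
      = (\<Sum>k\<le>N. of_nat (N choose k) * (x ^ (q + 1)) ^ k * (- y) ^ (N - k))"
    by (rule binomial_ring)
  also have "\<dots> * y ^ (p * w) / x ^ L = (\<Sum>k\<le>N. T k)"
  proof -
    have emb_C: "emb (C k) = of_nat (N choose k) * (- 1) ^ (N - k)" for k
      by (simp add: C_def emb_mult emb_power emb_uminus emb_one emb_of_nat)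
    have "T k = of_nat (N choose k) * (x ^ (q + 1)) ^ k * (- y) ^ (N - k) * y ^ (p * w) / x ^ L" for k
      unfolding T_def emb_C power_mult power_add[of y] power_minus[of y]
      by (simp only: mult_ac times_divide_eq_right times_divide_eq_left)
    then show ?thesis
      by (simp only: sum_distrib_right sum_divide_distrib)
  qed
  also have "\<dots> = (\<Sum>k<i1. T k) + T i1 + (\<Sum>l<N - i1. T (i1 + 1 + l))"
  proof -
    have "(\<Sum>k<m + l. T k) = (\<Sum>k<m. T k) + (\<Sum>k<l. T (m + k))" for m l
      by (induction l) (auto simp: add.assoc)
    from this[of "i1 + 1" "N - i1"] le show ?thesis
      by (simp flip: lessThan_Suc_atMost)
  qed
  finally have expand: "(y ^ (q - 1) / (x ^ (I + 1) * y ^ J)) ^ p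
      = (\<Sum>k<i1. T k) + T i1 + (\<Sum>l<N - i1. T (i1 + 1 + l))" .
  have T_high: "T (i1 + 1 + l)
      = emb (C (i1 + 1 + l)) * (x ^ ((q + 1) * l + i1 + p * z + 1) * y ^ (N - (i1 + 1 + l) + p * w))" for l
  proof -
    have "(q + 1) * (i1 + 1 + l) = (q + 1) * l + i1 + p * z + 1 + L"
      unfolding L_def using qz by (simp add: algebra_simps)
    then show ?thesis
      unfolding T_def using x_nonzero by (simp only: power_add) simp
  qed
  \<comment> \<open>For k < i1 cancelling x leaves the exponent q (m+1) + g in the denominator,
    which exceeds the exponent of y because the latter is below q; so
    \<open>pole_order_bound\<close> applies.\<close>
  have T_low: "T k \<in> regular U2" if k: "k < i1" for k
  proof -
    obtain m where m: "i1 = k + 1 + m"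
      using less_imp_Suc_add[OF k] by auto
    have "p * 1 \<le> p * (u + 1)" by (intro mult_le_mono) auto
    moreover have "k < p" using k le p by linarith
    ultimately have "k \<le> p * (u + 1)" by linarith
    then obtain g where g: "p * (u + 1) = k + g" using le_Suc_ex by blast
    have L: "L = (q + 1) * k + (q * (m + 1) + g)"
      unfolding L_def g m by (simp add: algebra_simps)
    have "N - k + p * w < q" using p qw by linarith
    then have "(q + 1) * (N - k + p * w) \<le> q * (q * (m + 1) + g)"
      by (intro pole_order_bound) (auto intro: less_le_trans)
    then have "emb (C k) * (y ^ (N - k + p * w) / x ^ (q * (m + 1) + g)) \<in> regular U2"
      by (intro regular_mult regular_emb regular_U2_monomial)
    then show ?thesis
      unfolding T_def L power_add[of x "(q + 1) * k"] using x_nonzero by simp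
  qed
  have T_mid: "T i1 = emb (C i1) * (y ^ (N - i1 + p * w) / x ^ (p * (u + 1) - i1))"
  proof -
    have "p * 1 \<le> p * (u + 1)" by (intro mult_le_mono) auto
    then have "i1 \<le> p * (u + 1)" using le p by linarith
    then have "L = (q + 1) * i1 + (p * (u + 1) - i1)"
      unfolding L_def by (simp add: algebra_simps)
    then show ?thesis
      unfolding T_def using x_nonzero by (simp only: power_add) simp
  qed
  have D0_T: "D0 (T (i1 + 1 + l)) = G l - G (Suc l)" if "l < N - i1" for l
  proof -
    define k where "k = i1 + 1 + l"
    define e where "e = (q + 1) * l + i1 + p * z"
    define b where "b = N - k + p * w"
    have k: "k \<le> N" using that le by (simp add: k_def)
    have "of_nat (e + 1) = (of_nat (p * (r * l + z) + k) :: 'F)"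
      by (simp add: e_def k_def q_eq algebra_simps)
    then have e: "of_nat (e + 1) = emb (of_nat k)"
      by (simp add: of_nat_p emb_of_nat del: of_nat_Suc)
    have b: "of_nat b = emb (of_nat (N - k))"
      by (simp add: b_def of_nat_p emb_of_nat)
    have "D0 (T k) = emb (C k) * (of_nat (e + 1) * x ^ e * y ^ b + of_nat b * y ^ (b - 1) * x ^ q * x ^ (e + 1))"
      unfolding k_def T_high D0_mult D0_emb derivation_power[of D0, OF D0_mult] D0_x D0_y
      by (fold e_def k_def b_def) (simp del: of_nat_Suc of_nat_add add: algebra_simps)
    also have "\<dots> = emb (of_nat k * C k) * (x ^ e * y ^ b)
        + emb (of_nat (N - k) * C k) * (x ^ (q + (e + 1)) * y ^ (b - 1))"
      unfolding e b emb_mult power_add[of x q] by (simp only: distrib_left mult_ac)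
    also have "emb (of_nat (N - k) * C k) * (x ^ (q + (e + 1)) * y ^ (b - 1)) = - G (Suc l)"
    proof -
      have "emb (of_nat (N - k) * C k) = - emb (of_nat (k + 1) * C (k + 1))"
        unfolding C_rec[OF k] by (simp add: emb_uminus)
      moreover have "C (N + 1) = 0"
        by (simp add: C_def binomial_eq_0)
      \<comment> \<open>Truncated subtraction may spoil the exponents at k = N, but there N - k = 0
        and C (N+1) = 0, so both sides are 0.\<close>
      moreover have "b - 1 = N - (k + 1) + p * w" if "k \<noteq> N"
        using k that by (simp add: b_def)
      moreover have "q + (e + 1) = (q + 1) * Suc l + i1 + p * z" "k + 1 = i1 + 1 + Suc l"
        by (simp_all add: e_def k_def)
      ultimately show ?thesis
        unfolding G_def by (cases "k = N") (simp_all only: mult_zero_right mult_zero_left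
            emb_zero minus_zero minus_mult_left not_False_eq_True simp_thms)
    qed
    finally show ?thesis
      unfolding G_def by (simp add: e_def k_def b_def)
  qed
  define A where "A = (\<Sum>l<N - i1. T (i1 + 1 + l))"
  have "D0 A = (\<Sum>l<N - i1. G l - G (Suc l))"
    unfolding A_def additive_sum[of D0, OF D0_add] using D0_T by (intro sum.cong) auto
  also have "\<dots> = G 0 - G (N - i1)"
    by (rule sum_lessThan_telescope')
  also have "G (N - i1) = 0"
    using le by (simp add: G_def C_def emb_zero binomial_eq_0)
  \<comment> \<open>The recursion expresses the boundary term through C i1, the coefficient of the
    middle term.\<close>
  also have "G 0 = emb (- of_nat (N - i1) * C i1) * (x ^ (i1 + p * z) * y ^ (N - i1 - 1 + p * w))"
    unfolding C_rec[OF le, symmetric] G_def by simp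
  finally have D0_A: "D0 A = emb (- of_nat (N - i1) * C i1) * (x ^ (i1 + p * z) * y ^ (N - i1 - 1 + p * w))"
    by simp
  have "A \<in> regular U1"
    unfolding A_def T_high by (intro regular_sum regular_mult[OF regular_emb] regular_U1_monomial)
  moreover have "(\<Sum>k<i1. T k) \<in> regular U2"
    using T_low by (intro regular_sum) auto
  moreover have "C i1 \<noteq> 0"
  proof -
    have "\<not> p dvd (N choose i1)"
      using prime_p le p by (intro prime_not_dvd_choose) auto
    then show ?thesis
      using char_k by (simp add: C_def of_nat_eq_0_iff_char_dvd)
  qed
  moreover have "(y ^ (q - 1) / (x ^ (I + 1) * y ^ J)) ^ p
      = A + emb (C i1) * (y ^ (N - i1 + p * w) / x ^ (p * (u + 1) - i1)) + (\<Sum>k<i1. T k)"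
    unfolding expand T_mid A_def by simp
  ultimately show ?thesis
    using D0_A by blast
qed

text \<open>With i1 = p-1-s and j1 = s+t+1-p the middle term of \<open>frob_expansion\<close> is c
  f_{i,j}. The rest is the coboundary of (A, -B): \<open>D0 A\<close> gives -c times the first form,
  and d(f_{I,J}^p) = 0 then determines dB without differentiating \<open>B\<close>.\<close>

lemma frob_triple_Ft_omega_shift:
  assumes "i + j \<le> q - 2" "omega_shift p r i j I J"
  shows "\<exists>c. c \<noteq> 0 \<and>
    frob_triple (basis_triple (Ft I J)) - scale_triple c (basis_triple (Ft i j)) \<in> coboundaries"
proof -
  obtain s t u v where *: "s < p" "t < p" "p \<le> s + t + 1" "u < r" "v < r" "i = s + p * u" "j = t + p * v"
    "I = u + r * (p - 1 - s)" "J = v + r * (s + t + 1 - p)"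
    using assms unfolding omega_shift_def by blast
  define w z N where "w = r - 1 - v" and "z = r - 1 - u" and "N = p - 1 - (s + t + 1 - p)"
  have "p = (s + t + 1 - p) + 1 + N" "p - 1 - s \<le> N" "r = v + 1 + w" "r = u + 1 + z"
    using *(1-5) by (simp_all add: w_def z_def N_def)
  from frob_expansion[OF this *(8,9)] obtain A B c where AB: "A \<in> regular U1" "B \<in> regular U2"
    and c: "c \<noteq> 0"
    and expand: "(y ^ (q - 1) / (x ^ (I + 1) * y ^ J)) ^ p
      = A + emb c * (y ^ (N - (p - 1 - s) + p * w) / x ^ (p * (u + 1) - (p - 1 - s))) + B"
    and D0_A: "D0 A = emb (- of_nat (N - (p - 1 - s)) * c)
      * (x ^ (p - 1 - s + p * z) * y ^ (N - (p - 1 - s) - 1 + p * w))"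
    by blast
  have N: "N - (p - 1 - s) = p - 1 - t"
    using *(1-3) by (simp add: N_def)
  have qj: "q - j - 1 = p - 1 - t + p * w" and qi: "q - i - 1 = p - 1 - s + p * z"
    unfolding *(6,7) w_def z_def using * by (simp_all only: complement_digits)
  have i: "p * (u + 1) - (p - 1 - s) = i + 1"
    using *(1) by (simp add: *(6) algebra_simps)
  have j: "j + 1 \<le> q" using assms(1) q_ge_4 by linarith
  have phi: "y ^ (N - (p - 1 - s) + p * w) / x ^ (p * (u + 1) - (p - 1 - s))
      = y ^ (q - 1) / (x ^ (i + 1) * y ^ j)"
    unfolding N i qj[symmetric] Ft_fun_eq[OF j] ..
  let ?f = "y ^ (q - 1) / (x ^ (i + 1) * y ^ j)"
  let ?\<eta>1 = "scaleD (- of_nat (j + 1) * y ^ (q - j - 2) * x ^ (q - i - 1)) (d x)"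
  let ?\<eta>2 = "scaleD (of_nat (i + 1) * y ^ (q - j - 1) / x ^ (i + 2)) (d x)"
  have dA: "d A = - scaleD (emb c) ?\<eta>1"
  proof -
    have coeff: "emb (- of_nat (p - 1 - t)) = of_nat (j + 1)"
    proof -
      have "of_nat (j + 1) = - (of_nat (p - 1 - t) :: 'F)"
        by (rule of_nat_cong_p[of _ _ "v + 1"]) (use *(2) in \<open>simp add: *(7) algebra_simps\<close>)
      then show ?thesis by (simp only: emb_uminus emb_of_nat)
    qed
    have "D0 A = of_nat (j + 1) * emb c * (x ^ (q - i - 1) * y ^ (q - j - 2))"
    \<comment> \<open>For t = p - 1 the truncated exponents of \<open>y\<close> may disagree, but
      then j + 1 is 0 in the field.\<close>
    proof (cases "t = p - 1")
      case True
      then have "of_nat (j + 1) = (0 :: 'F)"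
        using coeff by (simp add: emb_zero)
      then show ?thesis
        using True unfolding D0_A N by (simp add: emb_zero)
    next
      case False
      then have "q - j - 2 = p - 1 - t - 1 + p * w"
        using qj *(2) by linarith
      then show ?thesis
        unfolding D0_A N qi coeff emb_mult by simp
    qed
    then have "D0 A = - (emb c * (- of_nat (j + 1) * y ^ (q - j - 2) * x ^ (q - i - 1)))"
      by (simp only: mult_ac minus_mult_left[symmetric] mult_minus_right minus_minus)
    then show ?thesis
      by (simp only: d_eq[of A] scaleD_scaleD scaleD_uminus)
  qed
  have "d ((y ^ (q - 1) / (x ^ (I + 1) * y ^ J)) ^ p) = d A + scaleD (emb c) (d ?f) + d B"
    unfolding expand phi d_add d_emb_mult ..
  then have "d A + scaleD (emb c) (d ?f) + d B = 0"
    by (simp only: d_frob)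
  then have dB: "d (- B) = - scaleD (emb c) ?\<eta>2"
    unfolding d_Ft_fun[OF assms(1)] scaleD_right_diff dA d_uminus
    by (simp add: algebra_simps)
  have "(A - (- B), d A, d (- B)) \<in> coboundaries"
    using AB by (intro coboundaryI regular_uminus)
  also have "(A - (- B), d A, d (- B))
      = frob_triple (basis_triple (Ft I J)) - scale_triple c (basis_triple (Ft i j))"
    unfolding frob_triple_def basis_triple.simps fst_conv expand phi dA dB by simp
  finally show ?thesis using c by blast
qed

text \<open>With i1 = s and N = s + t + 1 the middle term is itself regular on \<open>U2\<close> and
  joins \<open>B\<close>. Subtracting the coboundary leaves the form -dA = (t+1) c omega_{i,j},
  whose factor t + 1 is invertible because t + 1 < p.\<close>

lemma frob_triple_Ft_f_shift:
  assumes "f_shift p r i j I J"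
  shows "\<exists>c. c \<noteq> 0 \<and>
    frob_triple (basis_triple (Ft I J)) - scale_triple c (basis_triple (Om i j)) \<in> coboundaries"
proof -
  obtain s t u v where *: "s + t + 2 \<le> p" "u < r" "v < r" "u + v + 1 \<le> r" "i = s + p * u" "j = t + p * v"
    "I = (r - 1 - u) + r * s" "J = (r - 1 - v) + r * (p - 2 - s - t)"
    using assms unfolding f_shift_def by blast
  have "p = (p - 2 - s - t) + 1 + (s + t + 1)" "s \<le> s + t + 1"
    "r = (r - 1 - v) + 1 + v" "r = (r - 1 - u) + 1 + u"
    using *(1-3) by simp_all
  from frob_expansion[OF this *(7,8)] obtain A B c where AB: "A \<in> regular U1" "B \<in> regular U2"
    and c: "c \<noteq> 0"
    and expand: "(y ^ (q - 1) / (x ^ (I + 1) * y ^ J)) ^ p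
      = A + emb c * (y ^ (s + t + 1 - s + p * v) / x ^ (p * (r - 1 - u + 1) - s)) + B"
    and D0_A: "D0 A = emb (- of_nat (s + t + 1 - s) * c) * (x ^ (s + p * u) * y ^ (s + t + 1 - s - 1 + p * v))"
    by blast
  define B' where "B' = emb c * (y ^ (s + t + 1 - s + p * v) / x ^ (p * (r - 1 - u + 1) - s)) + B"
  define c' where "c' = of_nat (t + 1) * c"
  have "c' \<noteq> 0"
  proof -
    have "\<not> p dvd t + 1" using *(1) by (simp add: nat_dvd_not_less)
    then show ?thesis
      using c char_k by (simp add: c'_def of_nat_eq_0_iff_char_dvd del: of_nat_Suc of_nat_add)
  qed
  \<comment> \<open>Here u + v + 1 <= r enters: it compares the blocks above the lowest digit, and s
    + t + 2 <= p settles the lowest digits, so the exponent of \<open>x\<close> exceeds that of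
    \<open>y\<close>.\<close>
  have "p * (v + 1) \<le> p * (r - 1 - u + 1)"
    using *(4) by (intro mult_le_mono le_refl) linarith
  moreover have "p * (v + 1) \<le> p * r"
    using * by (intro mult_le_mono) auto
  ultimately have "s + t + 1 - s + p * v < p * (r - 1 - u + 1) - s" "s + t + 1 - s + p * v \<le> q"
    using *(1) unfolding q_eq distrib_left by linarith+
  then have "(q + 1) * (s + t + 1 - s + p * v) \<le> q * (p * (r - 1 - u + 1) - s)"
    by (rule pole_order_bound)
  then have B': "B' \<in> regular U2"
    unfolding B'_def using AB(2)
    by (intro regular_add regular_mult regular_emb regular_U2_monomial)
  have dA: "d A = - scaleD (emb c') (scaleD (x ^ i * y ^ j) (d x))"
  proof -
    have "D0 A = - (emb c' * (x ^ i * y ^ j))"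
      unfolding D0_A c'_def *(5,6) by (simp add: emb_uminus emb_mult del: of_nat_Suc of_nat_add)
    then show ?thesis
      by (simp only: d_eq[of A] scaleD_scaleD scaleD_uminus)
  qed
  have expand': "(y ^ (q - 1) / (x ^ (I + 1) * y ^ J)) ^ p = A + B'"
    unfolding expand B'_def by (simp only: add.assoc)
  have "d A + d B' = d ((y ^ (q - 1) / (x ^ (I + 1) * y ^ J)) ^ p)"
    unfolding expand' d_add ..
  then have "d (- B') = d A"
    unfolding d_frob d_uminus by (metis neg_eq_iff_add_eq_0 add.commute)
  have "(A - (- B'), d A, d (- B')) \<in> coboundaries"
    using AB B' by (intro coboundaryI regular_uminus)
  also have "(A - (- B'), d A, d (- B'))
      = frob_triple (basis_triple (Ft I J)) - scale_triple c' (basis_triple (Om i j))"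
    unfolding frob_triple_def basis_triple.simps fst_conv expand' \<open>d (- B') = d A\<close> dA by simp
  finally show ?thesis using \<open>c' \<noteq> 0\<close> by blast
qed

end

subsection \<open>Base-\<open>p\<close> digits and vectors\<close>

lemma trunc_eq_mod: "trunc p h m = m mod p ^ h"
proof (induction h)
  case (Suc h)
  have "m mod (p ^ h * p) = p ^ h * (m div p ^ h mod p) + m mod p ^ h"
    by (rule mod_mult2_eq)
  with Suc show ?case
    by (simp add: trunc_def digit_def mult.commute)
qed (simp add: trunc_def)

text \<open>In this form the entry is the carry out of digit h in the base-p sum i + j + 1.\<close>

lemma bvec_entry_eq_0_iff:
  "bvec_entry p h i j = 0 \<longleftrightarrow> i mod p ^ Suc h + j mod p ^ Suc h + 1 < p ^ Suc h"
  by (auto simp: bvec_entry_def trunc_eq_mod)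

lemma bit_neq_0_iff: "a \<noteq> 0 \<longleftrightarrow> a = (1 :: bit)"
  by (cases a) auto

lemma bit_eqI: "(a = 0 \<longleftrightarrow> b = 0) \<Longrightarrow> a = (b :: bit)"
  by (cases a; cases b) auto

lemma swap01_eq_0_iff: "swap01 a = 0 \<longleftrightarrow> a \<noteq> 0"
  by (simp add: swap01_def)

lemma swap01_inj: "swap01 a = swap01 b \<longleftrightarrow> a = b"
  by (cases a; cases b) (auto simp: swap01_def)

lemma mod_digit_cons:
  assumes "s < (p::nat)"
  shows "(s + p * u) mod p ^ Suc h = s + p * (u mod p ^ h)"
  using mod_mult2_eq[of "s + p * u" p "p ^ h"] assms by simp

text \<open>r - 1 is congruent to P - 1 modulo P, so complementation commutes with reduction modulo
  P.\<close>

lemma mod_complement: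
  assumes "(P::nat) dvd r" "u < r"
  shows "(r - 1 - u) mod P + u mod P + 1 = P"
proof -
  obtain m where m: "r = P * m" using assms by blast
  have P: "P > 0" using assms m by (cases P) auto
  have "u div P < m" using assms(2) m by (simp add: less_mult_imp_div_less mult.commute)
  then obtain k where k: "m = u div P + 1 + k"
    by (metis Suc_eq_plus1 add.assoc add.commute less_iff_Suc_add)
  have "r = P * (u div P) + P + P * k"
    unfolding m by (subst k) (simp add: distrib_left)
  moreover have "u = P * (u div P) + u mod P" by simp
  moreover have "u mod P < P" using P by simp
  ultimately have "r - 1 - u = (P - 1 - u mod P) + P * k" by linarith
  then have "(r - 1 - u) mod P = P - 1 - u mod P"
    using P by simp
  with \<open>u mod P < P\<close> show ?thesis by simp
qed

text \<open>The lowest digits carry a 1 into the next position, so the carries of i + j + 1 continue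
  as those of u + v + 1; multiples of r do not affect residues modulo P.\<close>

lemma omega_shift_entry:
  assumes "omega_shift p r i j I J" "p ^ Suc h dvd r"
  shows "bvec_entry p h I J = bvec_entry p (Suc h) i j"
proof (rule bit_eqI)
  obtain s t u v where *: "s < p" "t < p" "p \<le> s + t + 1" "i = s + p * u" "j = t + p * v"
    "I = u + r * (p - 1 - s)" "J = v + r * (s + t + 1 - p)"
    using assms unfolding omega_shift_def by blast
  define P where "P = p ^ Suc h"
  have "(z + r * k) mod P = z mod P" for z k
    using assms(2) unfolding P_def by (metis dvd_mult2 mod_add_right_eq mod_0_imp_dvd add.right_neutral dvd_imp_mod_0)
  then have IJ: "I mod P = u mod P" "J mod P = v mod P"
    by (simp_all add: *(6,7))
  have ij: "i mod p ^ Suc (Suc h) = s + p * (u mod P)" "j mod p ^ Suc (Suc h) = t + p * (v mod P)"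
    unfolding *(4,5) P_def using *(1,2) by (simp_all only: mod_digit_cons)
  have "u mod P + v mod P + 1 < P \<longleftrightarrow> s + p * (u mod P) + (t + p * (v mod P)) + 1 < p * P"
  proof
    assume "u mod P + v mod P + 1 < P"
    then have "p * (u mod P + v mod P + 2) \<le> p * P" by (intro mult_le_mono) auto
    then show "s + p * (u mod P) + (t + p * (v mod P)) + 1 < p * P"
      using *(1,2) by (simp add: distrib_left)
  next
    assume "s + p * (u mod P) + (t + p * (v mod P)) + 1 < p * P"
    then have "p * (u mod P + v mod P + 1) < p * P"
      using *(3) by (simp add: distrib_left)
    then show "u mod P + v mod P + 1 < P" by (simp only: mult_less_cancel1)
  qed
  then show "bvec_entry p h I J = 0 \<longleftrightarrow> bvec_entry p (Suc h) i j = 0"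
    unfolding bvec_entry_eq_0_iff ij P_def[symmetric] IJ by (simp add: P_def)
qed

text \<open>The lowest digits carry nothing, so the entry of (i, j) tells whether u + v reaches P
  modulo P-blocks. For the complements, (P-1-u) + (P-1-v) + 1 < P iff u + v >= P with u, v reduced
  modulo P, which reverses the answer.\<close>

lemma f_shift_entry:
  assumes "f_shift p r i j I J" "p ^ Suc h dvd r"
  shows "bvec_entry p h I J = swap01 (bvec_entry p (Suc h) i j)"
proof (rule bit_eqI)
  obtain s t u v where *: "s + t + 2 \<le> p" "u < r" "v < r" "i = s + p * u" "j = t + p * v"
    "I = (r - 1 - u) + r * s" "J = (r - 1 - v) + r * (p - 2 - s - t)"
    using assms unfolding f_shift_def by blast
  define P where "P = p ^ Suc h"
  have "(z + r * k) mod P = z mod P" for z k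
    using assms(2) unfolding P_def by (metis dvd_mult2 mod_add_right_eq mod_0_imp_dvd add.right_neutral dvd_imp_mod_0)
  then have IJ: "I mod P = (r - 1 - u) mod P" "J mod P = (r - 1 - v) mod P"
    by (simp_all add: *(6,7))
  have compl: "(r - 1 - u) mod P + u mod P + 1 = P" "(r - 1 - v) mod P + v mod P + 1 = P"
    using mod_complement assms(2) *(2,3) unfolding P_def by blast+
  have "s < p" "t < p" using *(1) by auto
  then have ij: "i mod p ^ Suc (Suc h) = s + p * (u mod P)" "j mod p ^ Suc (Suc h) = t + p * (v mod P)"
    unfolding *(4,5) P_def by (simp_all only: mod_digit_cons)
  have "s + p * (u mod P) + (t + p * (v mod P)) + 1 < p * P \<longleftrightarrow> u mod P + v mod P < P"
  proof
    assume "u mod P + v mod P < P"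
    then have "p * (u mod P + v mod P + 1) \<le> p * P" by (intro mult_le_mono) auto
    then show "s + p * (u mod P) + (t + p * (v mod P)) + 1 < p * P"
      using *(1) by (simp add: distrib_left)
  next
    assume "s + p * (u mod P) + (t + p * (v mod P)) + 1 < p * P"
    then have "p * (u mod P + v mod P) < p * P"
      by (simp add: distrib_left)
    then show "u mod P + v mod P < P" by (simp only: mult_less_cancel1)
  qed
  moreover have "(r - 1 - u) mod P + (r - 1 - v) mod P + 1 < P \<longleftrightarrow> \<not> u mod P + v mod P < P"
    using compl by linarith
  ultimately show "bvec_entry p h I J = 0 \<longleftrightarrow> swap01 (bvec_entry p (Suc h) i j) = 0"
    unfolding swap01_eq_0_iff bvec_entry_eq_0_iff ij P_def[symmetric] IJ by (simp add: P_def)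
qed

lemma omega_shift_low:
  assumes "omega_shift p r i j I J"
  shows "i mod p + j mod p + 1 \<ge> p"
  using assms unfolding omega_shift_def by auto

lemma f_shift_low:
  assumes "f_shift p r i j I J"
  shows "i mod p + j mod p + 1 < p"
  using assms unfolding f_shift_def by auto

lemma omega_shift_high:
  assumes "omega_shift p r i j I J"
  shows "I mod r + J mod r + 1 < r"
  using assms unfolding omega_shift_def by auto

lemma f_shift_high:
  assumes "f_shift p r i j I J"
  shows "\<not> I mod r + J mod r + 1 < r"
proof -
  obtain s t u v where *: "u < r" "v < r" "u + v + 1 \<le> r"
    "I = (r - 1 - u) + r * s" "J = (r - 1 - v) + r * (p - 2 - s - t)"
    using assms unfolding f_shift_def by blast
  then have "r - 1 - u < r" "r - 1 - v < r" by simp_all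
  then have "I mod r = r - 1 - u" "J mod r = r - 1 - v"
    unfolding *(4,5) mod_mult_self2 by simp_all
  then show ?thesis using *(1-3) by simp
qed

section \<open>Range and existence of the shifts\<close>

lemma omega_shift_bound:
  assumes "omega_shift p r i j I J"
  shows "i + j \<le> p * r - 2" "I + J \<le> p * r - 2"
proof -
  obtain s t u v where *: "s < p" "t < p" "p \<le> s + t + 1" "u + v + 2 \<le> r" "i = s + p * u" "j = t + p * v"
    "I = u + r * (p - 1 - s)" "J = v + r * (s + t + 1 - p)"
    using assms unfolding omega_shift_def by blast
  have "p * (u + v + 2) \<le> p * r" using *(4) by (intro mult_le_mono) auto
  then show "i + j \<le> p * r - 2"
    using * by (simp add: distrib_left)
  have "(p - 1 - s) + (s + t + 1 - p) = t" using * by simp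
  then have "I + J = u + v + r * t"
    unfolding *(7,8) by (metis (no_types) add.assoc add.left_commute distrib_left)
  moreover have "r * (t + 1) \<le> r * p" using *(2) by (intro mult_le_mono) auto
  ultimately show "I + J \<le> p * r - 2"
    using *(4) by (simp add: mult.commute)
qed

lemma f_shift_bound:
  assumes "f_shift p r i j I J"
  shows "i + j \<le> p * r - 2" "I + J \<le> p * r - 2"
proof -
  obtain s t u v where *: "s + t + 2 \<le> p" "u < r" "v < r" "u + v + 1 \<le> r" "i = s + p * u" "j = t + p * v"
    "I = (r - 1 - u) + r * s" "J = (r - 1 - v) + r * (p - 2 - s - t)"
    using assms unfolding f_shift_def by blast
  have "p * (u + v + 1) \<le> p * r" using *(4) by (intro mult_le_mono) auto
  then show "i + j \<le> p * r - 2"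
    using * by (simp add: distrib_left)
  have "s + (p - 2 - s - t) = p - 2 - t" using * by simp
  then have "I + J = (r - 1 - u) + (r - 1 - v) + r * (p - 2 - t)"
    unfolding *(7,8) by (metis (no_types) add.assoc add.left_commute distrib_left)
  moreover have "r * (p - 2 - t + 2) \<le> r * p" using *(1) by (intro mult_le_mono) auto
  moreover have "(r - 1 - u) + (r - 1 - v) + 2 \<le> r + r" using *(2,3) by linarith
  moreover have "r * (p - 2 - t + 2) = r * (p - 2 - t) + r + r" "p * r = r * p"
    by (simp_all add: distrib_left)
  ultimately show "I + J \<le> p * r - 2" by linarith
qed

text \<open>The bound on i + j leaves u + v < r, and even u + v + 1 < r when the lowest digits
  carry: these are the side conditions in the two definitions.\<close>

lemma shift_exists:
  assumes "2 \<le> p" "2 \<le> p * r" "i + j \<le> p * r - 2"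
  shows "\<exists>I J. if i mod p + j mod p + 1 < p then f_shift p r i j I J else omega_shift p r i j I J"
proof -
  define s t u v where "s = i mod p" "t = j mod p" "u = i div p" "v = j div p"
  note defs = this
  have ij: "i = s + p * u" "j = t + p * v" by (simp_all add: defs)
  have st: "s < p" "t < p" using assms by (simp_all add: defs)
  have bound: "s + t + p * (u + v) + 2 \<le> p * r"
    using assms(2,3) unfolding ij by (simp add: distrib_left)
  show ?thesis
  proof (cases "s + t + 1 < p")
    case True
    have "p * (u + v) < p * r" using bound by linarith
    then have "u + v < r" by (simp only: mult_less_cancel1)
    then have "f_shift p r i j ((r - 1 - u) + r * s) ((r - 1 - v) + r * (p - 2 - s - t))"
      unfolding f_shift_def using True ij
      by (intro exI[of _ s] exI[of _ t] exI[of _ u] exI[of _ v]) auto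
    with True show ?thesis unfolding defs[symmetric] by auto
  next
    case False
    have "p * (u + v + 1) < p * r" using bound False by (simp add: distrib_left)
    then have "u + v + 1 < r" by (simp only: mult_less_cancel1)
    then have "omega_shift p r i j (u + r * (p - 1 - s)) (v + r * (s + t + 1 - p))"
      unfolding omega_shift_def using False ij st
      by (intro exI[of _ s] exI[of _ t] exI[of _ u] exI[of _ v]) auto
    with False show ?thesis unfolding defs[symmetric] by auto
  qed
qed

text \<open>The quotients a, b by r are the top digits of I and J. The witnesses solve p-1-s = a,
  s+t+1-p = b in the first case and s = a, p-2-s-t = b in the second.\<close>

lemma unshift_exists:
  assumes "1 \<le> r" "2 \<le> p * r" "I + J \<le> p * r - 2"
  shows "\<exists>i j. if I mod r + J mod r + 1 < r then omega_shift p r i j I J else f_shift p r i j I J"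
proof -
  define a b u v where "a = I div r" "b = J div r" "u = I mod r" "v = J mod r"
  note defs = this
  have IJ: "I = u + r * a" "J = v + r * b" by (simp_all add: defs)
  have uv: "u < r" "v < r" using assms by (simp_all add: defs)
  have bound: "u + v + r * (a + b) + 2 \<le> r * p"
    using assms(2,3) unfolding IJ by (simp add: distrib_left mult.commute)
  show ?thesis
  proof (cases "u + v + 1 < r")
    case True
    have "r * (a + b) < r * p" using bound by linarith
    then have "a + b < p" by (simp only: mult_less_cancel1)
    then have "omega_shift p r ((p - 1 - a) + p * u) ((a + b) + p * v) I J"
      unfolding omega_shift_def using True IJ uv
      by (intro exI[of _ "p - 1 - a"] exI[of _ "a + b"] exI[of _ u] exI[of _ v]) auto
    with True show ?thesis unfolding defs[symmetric] by auto
  next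
    case False
    have "r * (a + b + 1) < r * p" using bound False by (simp add: distrib_left)
    then have "a + b + 1 < p" by (simp only: mult_less_cancel1)
    then have "f_shift p r (a + p * (r - 1 - u)) ((p - 2 - a - b) + p * (r - 1 - v)) I J"
      unfolding f_shift_def using False IJ uv
      by (intro exI[of _ a] exI[of _ "p - 2 - a - b"] exI[of _ "r - 1 - u"] exI[of _ "r - 1 - v"]) auto
    with False show ?thesis unfolding defs[symmetric] by auto
  qed
qed

section \<open>Vectors as lists with the last entry split off\<close>

lemma nth_vector:
  "(map g [0..<Suc m] @ [a]) ! Suc m = a"
  "h \<le> m \<Longrightarrow> (map g [0..<Suc m] @ [a]) ! h = g h"
  by (simp_all add: nth_append del: upt_Suc)

lemma Vvec_last_1: "Vvec (map g [0..<Suc m] @ [1]) =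
    (if g 0 = 0 then None else Some (map (\<lambda>h. g (Suc h)) [0..<m] @ [0, 1]))"
proof -
  have "map (\<lambda>h. (map g [0..<Suc m] @ [1]) ! h) [Suc 0..<Suc m] = map (\<lambda>h. g (Suc h)) [0..<m]"
    by (rule nth_equalityI) (auto simp: nth_vector simp del: upt_Suc)
  then show ?thesis
    by (simp add: Vvec_def nth_vector del: upt_Suc)
qed

lemma Vvec_last_0: "Vvec (map g [0..<Suc m] @ [0]) =
    (if g 0 = 1 then None else Some (map (\<lambda>h. swap01 (g (Suc h))) [0..<m] @ [1, 1]))"
proof -
  have "map (\<lambda>h. swap01 ((map g [0..<Suc m] @ [0]) ! h)) [Suc 0..<Suc m]
      = map (\<lambda>h. swap01 (g (Suc h))) [0..<m]"
    by (rule nth_equalityI) (auto simp: nth_vector simp del: upt_Suc)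
  then show ?thesis
    by (simp add: Vvec_def nth_vector del: upt_Suc)
qed

lemma Fvec_last_1: "Fvec (map g [0..<Suc m] @ [1]) = None"
  by (simp add: Fvec_def nth_vector del: upt_Suc)

lemma Fvec_last_0: "Fvec (map g [0..<Suc m] @ [0]) =
    Some (if g m = 0 then 1 # map g [0..<m] @ [0] else 0 # map (\<lambda>h. swap01 (g h)) [0..<m] @ [1])"
proof -
  have "map (\<lambda>h. (map g [0..<Suc m] @ [0]) ! h) [0..<m] = map g [0..<m]"
    "map (\<lambda>h. swap01 ((map g [0..<Suc m] @ [0]) ! h)) [0..<m] = map (\<lambda>h. swap01 (g h)) [0..<m]"
    by (auto simp: nth_vector simp del: upt_Suc)
  then show ?thesis
    by (simp add: Fvec_def nth_vector del: upt_Suc)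
qed

lemma vector_split:
  assumes "length b = Suc (Suc m)"
  shows "b = map (\<lambda>h. b ! h) [0..<Suc m] @ [b ! Suc m]"
  using assms by (intro nth_equalityI) (auto simp: nth_append less_Suc_eq simp del: upt_Suc)

subsection \<open>The images of the parts\<close>

context hermitian_curve
begin

text \<open>Common frame for \<open>V\<close> and \<open>F\<close>: \<open>R\<close> links a symbol
  to that of its image up to a nonzero scalar and is compatible with vectors. Symbols without a
  partner are covered by \<open>none\<close>, and \<open>onto\<close> asks for a preimage with
  vector exactly \<open>b\<close>.\<close>

lemma image_H1dR_part:
  assumes \<Phi>: "\<And>t. t \<in> cocycles \<Longrightarrow> \<Phi> (dR_class t) = dR_class (T t)"
    and T_add: "\<And>s t. s \<in> cocycles \<Longrightarrow> t \<in> cocycles \<Longrightarrow> T (s + t) = T s + T t"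
    and T_scale: "\<And>c t. t \<in> cocycles \<Longrightarrow> T (scale_triple c t) = scale_triple (\<sigma> c) (T t)"
    and \<sigma>: "\<And>c. \<exists>a. \<sigma> a = c"
    and R_symbols: "\<And>e e'. R e e' \<Longrightarrow> e \<in> basis_symbols \<and> e' \<in> basis_symbols"
    and R_vec: "\<And>e e'. R e e' \<Longrightarrow> vec (bvec p n e) = Some (bvec p n e')"
    and R_triple: "\<And>e e'. R e e' \<Longrightarrow>
      \<exists>c. c \<noteq> 0 \<and> T (basis_triple e) - scale_triple c (basis_triple e') \<in> coboundaries"
    and total: "\<And>e. e \<in> basis_symbols \<Longrightarrow> vec (bvec p n e) \<noteq> None \<Longrightarrow> \<exists>e'. R e e'"
    and none: "\<And>e. e \<in> basis_symbols \<Longrightarrow> vec (bvec p n e) = None \<Longrightarrow> T (basis_triple e) \<in> coboundaries"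
    and onto: "\<And>e'. e' \<in> basis_symbols \<Longrightarrow> vec b = Some (bvec p n e') \<Longrightarrow> \<exists>e. R e e' \<and> bvec p n e = b"
  shows "\<Phi> ` H1dR_part (Some b) = H1dR_part (vec b)"
proof -
  define E where "E b = {e \<in> basis_symbols. bvec p n e = b}" for b
  have part: "H1dR_part (Some b) = dR_span ((\<lambda>e. dR_class (basis_triple e)) ` E b)" for b
    by (auto simp: E_def basis_elem_eq intro!: arg_cong[of _ _ dR_span])
  have cocycle: "basis_triple e \<in> cocycles" if "e \<in> E b" for e b
    using that basis_triple_cocycle by (simp add: E_def)
  show ?thesis
  proof (cases "vec b")
    case None
    have "\<Phi> ` dR_span ((\<lambda>e. dR_class (basis_triple e)) ` E b) = {dR_class 0}"
      by (rule semilinear_image_span_zero[where T = T and \<sigma> = \<sigma>, OF \<Phi> T_add T_scale cocycle])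
        (use None none in \<open>auto simp: E_def\<close>)
    then show ?thesis
      by (simp only: part None H1dR_part.simps(1))
  next
    case (Some b')
    have "\<Phi> ` dR_span ((\<lambda>e. dR_class (basis_triple e)) ` E b)
        = dR_span ((\<lambda>e. dR_class (basis_triple e)) ` E b')"
    proof (rule semilinear_image_span[where T = T and \<sigma> = \<sigma>, OF \<Phi> T_add T_scale cocycle cocycle \<sigma>])
      fix e assume "e \<in> E b"
      then obtain e' where e': "R e e'"
        using total Some by (auto simp: E_def)
      then have "e' \<in> E b'"
        using R_symbols[OF e'] R_vec[OF e'] Some \<open>e \<in> E b\<close> by (simp add: E_def)
      with R_triple[OF e'] show "\<exists>e' \<in> E b'. \<exists>c. T (basis_triple e) - scale_triple c (basis_triple e') \<in> coboundaries"
        by blast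
    next
      fix e' assume "e' \<in> E b'"
      then obtain e where e: "R e e'" "bvec p n e = b"
        using onto Some by (auto simp: E_def)
      then have "e \<in> E b"
        using R_symbols by (simp add: E_def)
      with R_triple[OF e(1)] show "\<exists>e \<in> E b. \<exists>c. c \<noteq> 0 \<and>
          T (basis_triple e) - scale_triple c (basis_triple e') \<in> coboundaries"
        by blast
    qed assumption+
    then show ?thesis
      by (simp only: part Some)
  qed
qed

lemma Om_in_basis_symbols: "Om i j \<in> basis_symbols \<longleftrightarrow> i + j \<le> p * r - 2"
  unfolding q_eq[symmetric] by (auto simp: basis_symbols_def \<Delta>_def)

lemma Ft_in_basis_symbols: "Ft i j \<in> basis_symbols \<longleftrightarrow> i + j \<le> p * r - 2"
  unfolding q_eq[symmetric] by (auto simp: basis_symbols_def \<Delta>_def)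

lemma pr_ge_2: "2 \<le> p * r"
  using q_ge_4 unfolding q_eq by linarith

lemma power_dvd_r: "h \<le> n - 2 \<Longrightarrow> p ^ Suc h dvd r"
  using n_ge_2 by (intro le_imp_power_dvd) simp

lemma power_Suc_n: "p ^ Suc (n - 2) = r"
proof -
  have "Suc (n - 2) = n - 1" using n_ge_2 by linarith
  then show ?thesis by (simp only:)
qed

lemma bvec_0_eq_0_iff: "bvec_entry p 0 i j = 0 \<longleftrightarrow> i mod p + j mod p + 1 < p"
  by (simp add: bvec_entry_eq_0_iff)

lemma bvec_last_eq_0_iff: "bvec_entry p (n - 2) i j = 0 \<longleftrightarrow> i mod r + j mod r + 1 < r"
  unfolding bvec_entry_eq_0_iff power_Suc_n ..

lemma bvec_eqs:
  "bvec p n (Om i j) = map (\<lambda>h. bvec_entry p h i j) [0..<Suc (n - 2)] @ [1]"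
  "bvec p n (Ft i j) = map (\<lambda>h. bvec_entry p h i j) [0..<Suc (n - 2)] @ [0]"
proof -
  have "n - 1 = Suc (n - 2)" using n_ge_2 by linarith
  then show "bvec p n (Om i j) = map (\<lambda>h. bvec_entry p h i j) [0..<Suc (n - 2)] @ [1]"
    "bvec p n (Ft i j) = map (\<lambda>h. bvec_entry p h i j) [0..<Suc (n - 2)] @ [0]"
    by (simp_all only: bvec.simps)
qed

lemma upt_Suc_front: "map g [0..<Suc m] = g 0 # map (\<lambda>h. g (Suc h)) [0..<m]"
  by (simp add: upt_conv_Cons map_Suc_upt[symmetric] del: upt_Suc)

lemma omega_shift_vectors:
  assumes "omega_shift p r i j I J"
  shows "bvec_entry p 0 i j = 1" "bvec_entry p (n - 2) I J = 0"
    "\<And>h. h < n - 2 \<Longrightarrow> bvec_entry p h I J = bvec_entry p (Suc h) i j"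
proof -
  show "bvec_entry p 0 i j = 1" "bvec_entry p (n - 2) I J = 0"
    using omega_shift_low[OF assms] omega_shift_high[OF assms]
    by (simp_all add: bvec_last_eq_0_iff bvec_0_eq_0_iff flip: bit_neq_0_iff)
qed (use omega_shift_entry[OF assms power_dvd_r] in simp)

lemma f_shift_vectors:
  assumes "f_shift p r i j I J"
  shows "bvec_entry p 0 i j = 0" "bvec_entry p (n - 2) I J = 1"
    "\<And>h. h < n - 2 \<Longrightarrow> bvec_entry p h I J = swap01 (bvec_entry p (Suc h) i j)"
proof -
  show "bvec_entry p 0 i j = 0" "bvec_entry p (n - 2) I J = 1"
    using f_shift_low[OF assms] f_shift_high[OF assms]
    by (simp_all add: bvec_last_eq_0_iff bvec_0_eq_0_iff flip: bit_neq_0_iff)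
qed (use f_shift_entry[OF assms power_dvd_r] in simp)

lemma shift_cases:
  assumes "i + j \<le> p * r - 2"
  shows "bvec_entry p 0 i j = 1 \<Longrightarrow> \<exists>I J. omega_shift p r i j I J"
    and "bvec_entry p 0 i j = 0 \<Longrightarrow> \<exists>I J. f_shift p r i j I J"
  using shift_exists[OF p_ge_2 pr_ge_2 assms] bvec_0_eq_0_iff[of i j] by auto

lemma unshift_cases:
  assumes "I + J \<le> p * r - 2"
  shows "bvec_entry p (n - 2) I J = 0 \<Longrightarrow> \<exists>i j. omega_shift p r i j I J"
    and "bvec_entry p (n - 2) I J = 1 \<Longrightarrow> \<exists>i j. f_shift p r i j I J"
  using unshift_exists[OF _ pr_ge_2 assms] r_pos bvec_last_eq_0_iff[of I J] by auto

inductive V_rel :: "basis_symbol \<Rightarrow> basis_symbol \<Rightarrow> bool"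
  where
    "omega_shift p r i j I J \<Longrightarrow> V_rel (Om i j) (Om I J)"
  | "f_shift p r i j I J \<Longrightarrow> V_rel (Ft i j) (Om I J)"

text \<open>There is no clause with source \<open>Om\<close>: the first entry of its triple is 0, so
  Frobenius kills it.\<close>

inductive F_rel :: "basis_symbol \<Rightarrow> basis_symbol \<Rightarrow> bool"
  where
    "omega_shift p r i j I J \<Longrightarrow> F_rel (Ft I J) (Ft i j)"
  | "f_shift p r i j I J \<Longrightarrow> F_rel (Ft I J) (Om i j)"

lemma V_image_H1dR_part:
  assumes b: "length b = n"
  shows "V ` H1dR_part (Some b) = H1dR_part (Vvec b)"
proof (rule image_H1dR_part[where R = V_rel and T = cartier_triple and \<sigma> = k_root_of])
  fix e e' assume "V_rel e e'"
  then show "e \<in> basis_symbols \<and> e' \<in> basis_symbols"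
    by cases (simp_all add: Om_in_basis_symbols Ft_in_basis_symbols omega_shift_bound f_shift_bound)
next
  fix e e' assume "V_rel e e'"
  then show "Vvec (bvec p n e) = Some (bvec p n e')"
  proof cases
    case (1 i j I J)
    note * = omega_shift_vectors[OF 1(3)]
    show ?thesis
      unfolding 1(1,2) bvec_eqs Vvec_last_1 by (simp add: *)
  next
    case (2 i j I J)
    note * = f_shift_vectors[OF 2(3)]
    show ?thesis
      unfolding 2(1,2) bvec_eqs Vvec_last_0 by (simp add: *)
  qed
next
  fix e e' assume "V_rel e e'"
  then have "\<exists>c. c \<noteq> 0 \<and> cartier_triple (basis_triple e) = scale_triple c (basis_triple e')"
    by cases (use cartier_triple_Om cartier_triple_Ft_shift f_shift_bound(1) in \<open>auto simp only: q_eq\<close>)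
  then show "\<exists>c. c \<noteq> 0 \<and> cartier_triple (basis_triple e) - scale_triple c (basis_triple e') \<in> coboundaries"
    using coboundaries_zero by auto
next
  fix e assume e: "e \<in> basis_symbols" "Vvec (bvec p n e) \<noteq> None"
  show "\<exists>e'. V_rel e e'"
  proof (cases e)
    case (Om i j)
    then have "i + j \<le> p * r - 2" "bvec_entry p 0 i j = 1"
      using e by (auto simp only: Om_in_basis_symbols bvec_eqs Vvec_last_1 bit_neq_0_iff split: if_splits)
    then show ?thesis
      unfolding Om using shift_cases(1) V_rel.intros(1) by blast
  next
    case (Ft i j)
    then have "i + j \<le> p * r - 2" "bvec_entry p 0 i j = 0"
      using e by (auto simp only: Ft_in_basis_symbols bvec_eqs Vvec_last_0 bit_neq_0_iff[symmetric] split: if_splits)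
    then show ?thesis
      unfolding Ft using shift_cases(2) V_rel.intros(2) by blast
  qed
next
  fix e assume e: "e \<in> basis_symbols" "Vvec (bvec p n e) = None"
  have "cartier_triple (basis_triple e) = 0"
  proof (cases e)
    case (Om i j)
    then have "bvec_entry p 0 i j = 0"
      using e by (auto simp only: bvec_eqs Vvec_last_1 split: if_splits)
    then show ?thesis
      unfolding Om bvec_0_eq_0_iff by (rule cartier_triple_Om_zero)
  next
    case (Ft i j)
    then have "bvec_entry p 0 i j \<noteq> 0" "i + j \<le> q - 2"
      using e by (auto simp only: Ft_in_basis_symbols q_eq bvec_eqs Vvec_last_0 bit_neq_0_iff split: if_splits)
    then show ?thesis
      unfolding Ft bvec_0_eq_0_iff by (intro cartier_triple_Ft_zero) auto
  qed
  then show "cartier_triple (basis_triple e) \<in> coboundaries"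
    by (simp add: coboundaries_zero)
next
  fix e' assume e': "e' \<in> basis_symbols" "Vvec b = Some (bvec p n e')"
  define m where "m = n - 2"
  have n: "n = Suc (Suc m)" using n_ge_2 by (simp add: m_def)
  define g where "g = (\<lambda>h. b ! h)"
  have "length b = Suc (Suc m)" using b n by simp
  then have split: "b = map g [0..<Suc m] @ [b ! Suc m]"
    unfolding g_def by (rule vector_split)
  show "\<exists>e. V_rel e e' \<and> bvec p n e = b"
  proof (cases "b ! Suc m = 0")
    case False
    then have split: "b = map g [0..<Suc m] @ [1]"
      using split by (simp only: bit_neq_0_iff)
    have "g 0 \<noteq> 0" "Some (map (\<lambda>h. g (Suc h)) [0..<m] @ [0, 1]) = Some (bvec p n e')"
      using e'(2) unfolding split Vvec_last_1 by (auto split: if_splits)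
    then have g: "g 0 = 1" and vec: "bvec p n e' = map (\<lambda>h. g (Suc h)) [0..<m] @ [0, 1]"
      by (simp_all only: bit_neq_0_iff option.inject)
    \<comment> \<open>The last entry 1 singles out the symbols \<open>Om\<close>.\<close>
    from vec obtain I J where IJ: "e' = Om I J"
      by (cases e') (simp_all add: bvec_eqs del: bvec.simps)
    with vec have entries: "\<forall>h<m. bvec_entry p h I J = g (Suc h)" "bvec_entry p m I J = 0"
      by (simp_all add: bvec_eqs m_def[symmetric] del: bvec.simps)
    obtain i j where ij: "omega_shift p r i j I J"
      using unshift_cases(1)[of I J] e'(1) IJ entries(2) by (auto simp: Om_in_basis_symbols m_def)
    have "bvec p n (Om i j) = b"
      unfolding split bvec_eqs m_def[symmetric] upt_Suc_front
      using omega_shift_vectors[OF ij] g entries by (simp add: m_def)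
    then show ?thesis
      using V_rel.intros(1)[OF ij] IJ by blast
  next
    case True
    then have split: "b = map g [0..<Suc m] @ [0]"
      using split by (simp only:)
    have "g 0 \<noteq> 1" and vec: "bvec p n e' = map (\<lambda>h. swap01 (g (Suc h))) [0..<m] @ [1, 1]"
      using e'(2) unfolding split Vvec_last_0 by (auto split: if_splits)
    then have g: "g 0 = 0"
      using bit_neq_0_iff by blast
    from vec obtain I J where IJ: "e' = Om I J"
      by (cases e') (simp_all add: bvec_eqs del: bvec.simps)
    with vec have entries: "\<forall>h<m. bvec_entry p h I J = swap01 (g (Suc h))" "bvec_entry p m I J = 1"
      by (simp_all add: bvec_eqs m_def[symmetric] del: bvec.simps)
    obtain i j where ij: "f_shift p r i j I J"
      using unshift_cases(2)[of I J] e'(1) IJ entries(2) by (auto simp: Om_in_basis_symbols m_def)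
    have "bvec p n (Ft i j) = b"
      unfolding split bvec_eqs m_def[symmetric] upt_Suc_front
      using f_shift_vectors[OF ij] g entries by (simp add: m_def swap01_inj)
    then show ?thesis
      using V_rel.intros(2)[OF ij] IJ by blast
  qed
qed (fact V_dR_class cartier_triple_add cartier_triple_scale k_root_of_surj)+

lemma F_image_H1dR_part:
  assumes b: "length b = n"
  shows "F ` H1dR_part (Some b) = H1dR_part (Fvec b)"
proof (rule image_H1dR_part[where R = F_rel and T = frob_triple and \<sigma> = "\<lambda>c. c ^ p"])
  fix e e' assume "F_rel e e'"
  then show "e \<in> basis_symbols \<and> e' \<in> basis_symbols"
    by cases (simp_all add: Om_in_basis_symbols Ft_in_basis_symbols omega_shift_bound f_shift_bound)
next
  fix e e' assume "F_rel e e'"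
  then show "Fvec (bvec p n e) = Some (bvec p n e')"
  proof cases
    case (1 i j I J)
    note * = omega_shift_vectors[OF 1(3)]
    show ?thesis
      unfolding 1(1,2) bvec_eqs Fvec_last_0 upt_Suc_front[of "\<lambda>h. bvec_entry p h i j"] by (simp add: *)
  next
    case (2 i j I J)
    note * = f_shift_vectors[OF 2(3)]
    have "swap01 (swap01 a) = a" for a by (cases a) (simp_all add: swap01_def)
    then show ?thesis
      unfolding 2(1,2) bvec_eqs Fvec_last_0 upt_Suc_front[of "\<lambda>h. bvec_entry p h i j"] by (simp add: *)
  qed
next
  fix e e' assume "F_rel e e'"
  then show "\<exists>c. c \<noteq> 0 \<and> frob_triple (basis_triple e) - scale_triple c (basis_triple e') \<in> coboundaries"
    by cases (use frob_triple_Ft_omega_shift frob_triple_Ft_f_shift omega_shift_bound(1) in \<open>auto simp only: q_eq\<close>)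
next
  fix e assume e: "e \<in> basis_symbols" "Fvec (bvec p n e) \<noteq> None"
  show "\<exists>e'. F_rel e e'"
  proof (cases e)
    case (Om i j)
    then show ?thesis
      using e by (simp add: bvec_eqs Fvec_last_1 del: bvec.simps upt_Suc)
  next
    case (Ft I J)
    then have IJ: "I + J \<le> p * r - 2"
      using e by (simp only: Ft_in_basis_symbols)
    show ?thesis
    proof (cases "bvec_entry p (n - 2) I J = 0")
      case True
      then show ?thesis
        unfolding Ft using unshift_cases(1)[OF IJ] F_rel.intros(1) by blast
    next
      case False
      then show ?thesis
        unfolding Ft bit_neq_0_iff using unshift_cases(2)[OF IJ] F_rel.intros(2) by blast
    qed
  qed
next
  fix e assume "e \<in> basis_symbols" "Fvec (bvec p n e) = None"
  then obtain i j where "e = Om i j"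
    by (cases e) (auto simp only: bvec_eqs Fvec_last_0)
  then show "frob_triple (basis_triple e) \<in> coboundaries"
    by (simp only: frob_triple_Om coboundaries_zero)
next
  fix e' assume e': "e' \<in> basis_symbols" "Fvec b = Some (bvec p n e')"
  define m where "m = n - 2"
  have n: "n = Suc (Suc m)" using n_ge_2 by (simp add: m_def)
  define g where "g = (\<lambda>h. b ! h)"
  have "length b = Suc (Suc m)" using b n by simp
  then have split: "b = map g [0..<Suc m] @ [b ! Suc m]"
    unfolding g_def by (rule vector_split)
  \<comment> \<open>A last entry 1 would make \<open>Fvec b\<close> equal to
    \<open>None\<close>.\<close>
  have "b ! Suc m = 0"
    using e'(2) split Fvec_last_1[of g m] bit_neq_0_iff by (metis option.distinct(1))
  then have split: "b = map g [0..<Suc m] @ [0]"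
    using split by (simp only:)
  show "\<exists>e. F_rel e e' \<and> bvec p n e = b"
  proof (cases "g m = 0")
    case True
    have vec: "bvec p n e' = 1 # map g [0..<m] @ [0]"
      using e'(2) True unfolding split Fvec_last_0 by simp
    from vec have "last (bvec p n e') = 0" by simp
    then obtain i j where ij: "e' = Ft i j"
      by (cases e') simp_all
    with vec have entries: "\<forall>h<m. bvec_entry p (Suc h) i j = g h" "bvec_entry p 0 i j = 1"
      by (simp_all add: bvec_eqs upt_Suc_front m_def[symmetric] del: bvec.simps upt_Suc)
    obtain I J where IJ: "omega_shift p r i j I J"
      using shift_cases(1)[of i j] e'(1) ij entries(2) by (auto simp: Ft_in_basis_symbols)
    have "bvec p n (Ft I J) = b"
      unfolding split bvec_eqs m_def[symmetric]
      using omega_shift_vectors[OF IJ] True entries by (simp add: m_def)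
    then show ?thesis
      using F_rel.intros(1)[OF IJ] ij by blast
  next
    case False
    have vec: "bvec p n e' = 0 # map (\<lambda>h. swap01 (g h)) [0..<m] @ [1]"
      using e'(2) False unfolding split Fvec_last_0 by simp
    from vec have "last (bvec p n e') = 1" by simp
    then obtain i j where ij: "e' = Om i j"
      by (cases e') simp_all
    with vec have entries: "\<forall>h<m. bvec_entry p (Suc h) i j = swap01 (g h)" "bvec_entry p 0 i j = 0"
      by (simp_all add: bvec_eqs upt_Suc_front m_def[symmetric] del: bvec.simps upt_Suc)
    obtain I J where IJ: "f_shift p r i j I J"
      using shift_cases(2)[of i j] e'(1) ij entries(2) by (auto simp: Om_in_basis_symbols)
    have "swap01 (swap01 a) = a" for a by (cases a) (simp_all add: swap01_def)
    then have "bvec p n (Ft I J) = b"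
      unfolding split bvec_eqs m_def[symmetric]
      using f_shift_vectors[OF IJ] False[unfolded bit_neq_0_iff] entries by (simp add: m_def)
    then show ?thesis
      using F_rel.intros(2)[OF IJ] ij by blast
  qed
qed (simp_all only: F_dR_class frob_triple_add frob_triple_scale k_root)

end

theorem theorem4p4:
  fixes p n :: nat
    and emb :: "'k::alg_closed_field \<Rightarrow> 'F::field"
    and x y :: 'F
    and b :: "bit list"
  assumes "hermitian_curve p n emb x y"
    and "length b = n"
  shows "hermitian_curve.V p n emb x y ` hermitian_curve.H1dR_part p n emb x y (Some b)
       = hermitian_curve.H1dR_part p n emb x y (Vvec b)
     \<and> hermitian_curve.F p n emb x y ` hermitian_curve.H1dR_part p n emb x y (Some b)
       = hermitian_curve.H1dR_part p n emb x y (Fvec b)"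
  using hermitian_curve.V_image_H1dR_part[OF assms] hermitian_curve.F_image_H1dR_part[OF assms] ..

end
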